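(* Let $R$ be a connected reduced order. Suppose that $A$ and $B$ are stark subrings of $R$ and that $G$ and $H$ are subgroups of the unit group $R^*$ such that $A[G]=B[H]=R$. Then $A[H]=B[G]=R$.
   Context: All rings have a unit element. An order is a commutative ring whose additive group is isomorphic to $\mathbb{Z}^n$ for some $n\in\mathbb{Z}_{\geq 0}$. A commutative ring is reduced if it has no non-zero nilpotent elements, and connected if it has exactly two idempotents (i.e. it is non-zero and $0,1$ are its only idempotents). A commutative ring is stark if there do not exist a ring $A$ and a non-trivial group $G$ such that it is isomorphic to the group ring $A[G]$. For a commutative ring $R$, a subring $A\subset R$ and a subgroup $G\subset R^*$, one writes $A[G]=R$ if the natural ring homomorphism from the group ring $A[G]$ to $R$ is an isomorphism. *)

theory Defs
  imports Main
begin

definition is_order :: "'a::comm_ring_1 itself \<Rightarrow> bool" where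
  "is_order (TYPE('a)) \<longleftrightarrow>
     (\<exists>(n::nat) (\<phi>::'a \<Rightarrow> (nat \<Rightarrow> int)).
        bij_betw \<phi> UNIV {v. \<forall>i\<ge>n. v i = 0} \<and>
        (\<forall>x y. (\<forall>i. \<phi> (x + y) i = \<phi> x i + \<phi> y i)))"

definition is_reduced :: "'a::comm_ring_1 itself \<Rightarrow> bool" where
  "is_reduced (TYPE('a)) \<longleftrightarrow> (\<forall>x::'a. \<forall>k::nat. x ^ k = 0 \<longrightarrow> x = 0)"

definition is_connected :: "'a::comm_ring_1 itself \<Rightarrow> bool" where
  "is_connected (TYPE('a)) \<longleftrightarrow>
     (0::'a) \<noteq> 1 \<and> (\<forall>e::'a. e * e = e \<longrightarrow> e = 0 \<or> e = 1)"

definition subring :: "'a::comm_ring_1 set \<Rightarrow> bool" where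
  "subring A \<longleftrightarrow> 1 \<in> A \<and> (\<forall>x\<in>A. \<forall>y\<in>A. x + y \<in> A \<and> x - y \<in> A \<and> x * y \<in> A)"

definition unit_subgroup :: "'a::comm_ring_1 set \<Rightarrow> 'a set \<Rightarrow> bool" where
  "unit_subgroup G S \<longleftrightarrow> G \<subseteq> S \<and> 1 \<in> G \<and> (\<forall>g\<in>G. \<forall>h\<in>G. g * h \<in> G) \<and>
     (\<forall>g\<in>G. \<exists>h\<in>G. g * h = 1)"

text \<open>A[G] = S: the natural ring map from the group ring A[G] to S is an isomorphism,
  i.e. it is onto S and has trivial kernel.\<close>
definition group_ring_eq :: "'a::comm_ring_1 set \<Rightarrow> 'a set \<Rightarrow> 'a set \<Rightarrow> bool" where
  "group_ring_eq A G S \<longleftrightarrow>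
     {(\<Sum>g\<in>F. f g * g) | F f. finite F \<and> F \<subseteq> G \<and> f ` F \<subseteq> A} = S \<and>
     (\<forall>F f. finite F \<and> F \<subseteq> G \<and> f ` F \<subseteq> A \<and> (\<Sum>g\<in>F. f g * g) = 0
        \<longrightarrow> (\<forall>g\<in>F. f g = 0))"

text \<open>A (sub)ring A is stark if it is not a group ring C[K] over a non-trivial group K;
  rendered internally: no subring C of A and non-trivial subgroup K of the units of A
  with C[K] = A.\<close>
definition stark :: "'a::comm_ring_1 set \<Rightarrow> bool" where
  "stark A \<longleftrightarrow> \<not> (\<exists>C K. subring C \<and> C \<subseteq> A \<and> unit_subgroup K A \<and> K \<noteq> {1} \<and>
                       group_ring_eq C K A)"

end

theory Submission
  imports Defs "HOL-Computational_Algebra.Computational_Algebra"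
begin

text \<open>Let \<open>X\<close> be the finite set of ring homomorphisms from \<open>R\<close> to the complex numbers; a nonzero
  element of a reduced order has absolute value at least 1 at some point of \<open>X\<close>. Writing
  \<open>R = A[G]\<close> grades \<open>R\<close> by \<open>G\<close>, and twisting \<open>X\<close> by characters of \<open>G\<close> shows that the pieces are
  orthogonal for \<open>\<langle>x, y\<rangle> = \<Sum>\<sigma>\<in>X. \<sigma> x * cnj (\<sigma> y)\<close>. Hence the \<open>G\<close>-grading and the \<open>H\<close>-grading have a
  common refinement, and since \<open>R\<close> is connected, the elements of \<open>H\<close> are homogeneous for the
  \<open>G\<close>-grading and vice versa. If the resulting homomorphism \<open>H \<rightarrow> G\<close> had a kernel, a
  Fitting-type argument would exhibit \<open>A\<close> as a group ring over a nontrivial group. So both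
  degree maps are injective, hence bijective, and each \<open>h\<close> in \<open>H\<close> is a unit of \<open>A\<close> times its
  degree in \<open>G\<close>.\<close>

section \<open>Ring homomorphisms of a reduced order to the complex numbers\<close>

text \<open>Gaussian elimination without division: one unknown is eliminated by cross-multiplying
  with the pivot \<open>a n k0\<close>, so the solution stays in the domain. Over the integers this
  yields integral relations.\<close>

lemma homogeneous_system_solution:
  fixes a :: "nat \<Rightarrow> 'b \<Rightarrow> 'c::idom"
  assumes "finite S" and "n < card S"
  shows "\<exists>c. (\<exists>k\<in>S. c k \<noteq> 0) \<and> (\<forall>i<n. (\<Sum>k\<in>S. c k * a i k) = 0)"
  using assms
proof (induction n arbitrary: S a)
  case 0
  then have "S \<noteq> {}" by auto
  then show ?case by (intro exI[of _ "\<lambda>_. 1"]) auto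
next
  case (Suc n)
  show ?case
  proof (cases "\<forall>k\<in>S. a n k = 0")
    case True
    from Suc.IH[of S a] Suc.prems obtain c where
      "\<exists>k\<in>S. c k \<noteq> 0" "\<forall>i<n. (\<Sum>k\<in>S. c k * a i k) = 0" by auto
    with True show ?thesis by (intro exI[of _ c]) (auto simp: less_Suc_eq)
  next
    case False
    then obtain k0 where k0: "k0 \<in> S" "a n k0 \<noteq> 0" by auto
    let ?T = "S - {k0}"
    have T: "finite ?T" "n < card ?T" using Suc.prems k0 by auto
    obtain c where c: "\<exists>k\<in>?T. c k \<noteq> 0"
      "\<And>i. i < n \<Longrightarrow> (\<Sum>k\<in>?T. c k * (a n k0 * a i k - a i k0 * a n k)) = 0"
      using Suc.IH[OF T, of "\<lambda>i k. a n k0 * a i k - a i k0 * a n k"] by auto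
    \<comment> \<open>Scaling the other unknowns by \<open>a n k0\<close> lets equation
      \<open>n\<close> be solved for the pivot unknown.\<close>
    define d where "d = (\<lambda>k. if k = k0 then - (\<Sum>k\<in>?T. c k * a n k) else a n k0 * c k)"
    have sum_d: "(\<Sum>k\<in>S. d k * a i k)
        = (\<Sum>k\<in>?T. c k * (a n k0 * a i k - a i k0 * a n k))" for i
    proof -
      have "(\<Sum>k\<in>S. d k * a i k) = d k0 * a i k0 + (\<Sum>k\<in>?T. d k * a i k)"
        using Suc.prems k0 by (simp add: sum.remove)
      also have "(\<Sum>k\<in>?T. d k * a i k) = (\<Sum>k\<in>?T. a n k0 * c k * a i k)"
        by (intro sum.cong) (auto simp: d_def)
      also have "d k0 * a i k0 = (\<Sum>k\<in>?T. - (c k * a n k * a i k0))"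
        by (simp add: d_def sum_distrib_right sum_negf)
      finally show ?thesis
        by (simp add: sum.distrib[symmetric] algebra_simps)
    qed
    have "(\<Sum>k\<in>S. d k * a i k) = 0" if "i < Suc n" for i
    proof (cases "i = n")
      case True
      then show ?thesis by (simp add: sum_d mult.commute)
    next
      case False
      then show ?thesis using that c(2)[of i] by (simp add: sum_d)
    qed
    moreover have "\<exists>k\<in>S. d k \<noteq> 0" using c(1) k0 by (auto simp: d_def)
    ultimately show ?thesis by blast
  qed
qed

lemma order_basis:
  assumes "is_order TYPE('a::comm_ring_1)"
  shows "\<exists>n (b :: nat \<Rightarrow> 'a::comm_ring_1) (co :: nat \<Rightarrow> 'a \<Rightarrow> int).
    (\<forall>x. x = (\<Sum>i<n. of_int (co i x) * b i)) \<and> (\<forall>i. Modules.additive (co i))"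
proof -
  from assms obtain n and \<phi> :: "'a \<Rightarrow> nat \<Rightarrow> int"
    where bij: "bij_betw \<phi> UNIV {v. \<forall>i\<ge>n. v i = 0}"
      and add: "\<And>x y i. \<phi> (x + y) i = \<phi> x i + \<phi> y i"
    unfolding is_order_def by blast
  have additive: "Modules.additive (\<lambda>x. \<phi> x i)" for i
    by unfold_locales (rule add)
  \<comment> \<open>Preimages of the unit vectors. For \<open>i \<ge> n\<close> the unit vector is
    outside the range, and the arbitrary value of \<open>b i\<close> never enters a sum.\<close>
  define b where "b = (\<lambda>i. inv \<phi> (\<lambda>j. if j = i then 1 else 0))"
  have inj: "inj \<phi>" using bij by (simp add: bij_betw_def)
  have \<phi>_b: "\<phi> (b i) = (\<lambda>j. if j = i then 1 else 0)" if "i < n" for i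
    unfolding b_def
  proof (rule f_inv_into_f)
    show "(\<lambda>j. if j = i then 1 else 0) \<in> range \<phi>"
      using bij that by (auto simp: bij_betw_def)
  qed
  have \<phi>_nat: "\<phi> (of_nat m * x) j = int m * \<phi> x j" for m x j
    by (induction m) (simp_all add: additive.zero[OF additive] algebra_simps add)
  have \<phi>_int: "\<phi> (of_int m * x) j = m * \<phi> x j" for m x j
  proof (cases m)
    case (nonneg k)
    then show ?thesis by (simp add: \<phi>_nat)
  next
    case (neg k)
    then have "of_int m * x = - (of_nat (Suc k) * x)"
    by (simp only: of_int_minus of_int_of_nat_eq mult_minus_left)
    then show ?thesis using neg \<phi>_nat[of "Suc k"] by (simp only: additive.minus[OF additive])
  qed
  have "x = (\<Sum>i<n. of_int (\<phi> x i) * b i)" for x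
  proof (rule injD[OF inj], rule ext)
    fix j
    have "\<phi> (\<Sum>i<n. of_int (\<phi> x i) * b i) j = (\<Sum>i<n. \<phi> x i * \<phi> (b i) j)"
      by (simp add: additive.sum[OF additive] \<phi>_int)
    also have "\<dots> = (\<Sum>i<n. if j = i then \<phi> x i else 0)"
      by (intro sum.cong) (auto simp: \<phi>_b)
    also have "\<dots> = \<phi> x j"
    proof -
      have "\<phi> x \<in> {v. \<forall>i\<ge>n. v i = 0}" using bij by (auto simp: bij_betw_def)
      then show ?thesis by auto
    qed
    finally show "\<phi> x j = \<phi> (\<Sum>i<n. of_int (\<phi> x i) * b i) j" by simp
  qed
  then show ?thesis using additive by (intro exI[of _ "\<lambda>i x. \<phi> x i"] exI[of _ b] exI[of _ n]) auto
qed

lemma additive_of_nat_mult: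
  fixes f :: "'a::comm_ring_1 \<Rightarrow> 'b::comm_ring_1"
  assumes "Modules.additive f"
  shows "f (of_nat m * x) = of_nat m * f x"
  by (induction m)
    (simp_all add: additive.zero[OF assms] additive.add[OF assms] algebra_simps)

lemma additive_of_int_mult:
  fixes f :: "'a::comm_ring_1 \<Rightarrow> 'b::comm_ring_1"
  assumes "Modules.additive f"
  shows "f (of_int m * x) = of_int m * f x"
proof (cases m)
  case (nonneg k)
  then show ?thesis by (simp add: additive_of_nat_mult[OF assms])
next
  case (neg k)
  then have "of_int m * x = - (of_nat (Suc k) * x)"
    by (simp only: of_int_minus of_int_of_nat_eq mult_minus_left)
  then have "f (of_int m * x) = - (of_nat (Suc k) * f x)"
    by (simp only: additive.minus[OF assms] additive_of_nat_mult[OF assms])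
  also have "\<dots> = of_int m * f x"
    using neg by (simp only: of_int_minus of_int_of_nat_eq mult_minus_left)
  finally show ?thesis .
qed

lemma order_torsion_free:
  assumes "is_order TYPE('a::comm_ring_1)" and "of_int m * (x::'a::comm_ring_1) = 0" and "m \<noteq> 0"
  shows "x = 0"
proof -
  obtain n b and co :: "nat \<Rightarrow> 'a \<Rightarrow> int"
    where b: "\<And>x. x = (\<Sum>i<n. of_int (co i x) * b i)"
      and co: "\<And>i. Modules.additive (co i)"
    using order_basis[OF assms(1)] by blast
  have "co i x = 0" for i
    using additive_of_int_mult[OF co, of i m x] additive.zero[OF co, of i] assms by simp
  then show ?thesis by (subst b) simp
qed

text \<open>A relation amounts to one integer equation per coordinate. Indexing by \<open>S\<close>
  counts repeated elements separately, as powers of one element require.\<close>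

lemma order_linear_dependence:
  assumes "is_order TYPE('a::comm_ring_1)"
  shows "\<exists>n::nat. \<forall>(S::'b set) (x::'b \<Rightarrow> 'a::comm_ring_1). finite S \<longrightarrow> n < card S
    \<longrightarrow> (\<exists>c. (\<exists>k\<in>S. c k \<noteq> 0) \<and> (\<Sum>k\<in>S. of_int (c k) * x k) = 0)"
proof -
  obtain n b and co :: "nat \<Rightarrow> 'a \<Rightarrow> int"
    where b: "\<And>x. x = (\<Sum>i<n. of_int (co i x) * b i)"
      and co: "\<And>i. Modules.additive (co i)"
    using order_basis[OF assms(1)] by blast
  have "\<exists>c. (\<exists>k\<in>S. c k \<noteq> 0) \<and> (\<Sum>k\<in>S. of_int (c k) * x k) = 0"
    if S: "finite S" "n < card S" for S :: "'b set" and x :: "'b \<Rightarrow> 'a"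
  proof -
    obtain c where c: "\<exists>k\<in>S. c k \<noteq> 0" "\<And>i. i < n \<Longrightarrow> (\<Sum>k\<in>S. c k * co i (x k)) = 0"
      using homogeneous_system_solution[OF S, of "\<lambda>i k. co i (x k)"] by blast
    have "co i (\<Sum>k\<in>S. of_int (c k) * x k) = 0" if "i < n" for i
      using c(2)[OF that] by (simp add: additive.sum[OF co] additive_of_int_mult[OF co])
    then have "(\<Sum>k\<in>S. of_int (c k) * x k) = 0" by (subst b) simp
    with c(1) show ?thesis by blast
  qed
  then show ?thesis by blast
qed

section \<open>Eigenvalues of multiplication operators on additive functionals\<close>

text \<open>This is \<open>T - c\<close>, where \<open>T\<close> precomposes with multiplication by
  \<open>r\<close>. It is applied to additive functionals with complex values, which serve as the
  complexified dual of the ring, so no tensor product has to be formed.\<close>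

definition shift :: "'a::comm_ring_1 \<Rightarrow> complex \<Rightarrow> ('a \<Rightarrow> complex) \<Rightarrow> 'a \<Rightarrow> complex" where
  "shift r c f = (\<lambda>x. f (r * x) - c * f x)"

lemma shift_commute: "shift r c (shift s d f) = shift s d (shift r c f)"
  by (simp add: shift_def fun_eq_iff algebra_simps)

lemma shift_zero [simp]: "shift r c (\<lambda>_. 0) = (\<lambda>_. 0)"
  by (simp add: shift_def)

lemma additive_shift: "Modules.additive f \<Longrightarrow> Modules.additive (shift r c f)"
  by (simp add: Modules.additive_def shift_def algebra_simps)

lemma additive_foldr_shift:
  "Modules.additive f \<Longrightarrow> Modules.additive (foldr (shift r) cs f)"
  by (induction cs) (auto intro: additive_shift)

lemma shift_foldr_commute:
  "shift s d (foldr (shift r) cs f) = foldr (shift r) cs (shift s d f)"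
  by (induction cs) (auto simp: shift_commute[of s])

lemma foldr_shift_zero [simp]: "foldr (shift r) cs (\<lambda>_. 0) = (\<lambda>_. 0)"
  by (induction cs) auto

text \<open>The list encodes a polynomial by its roots with multiplicity; that polynomial kills
  multiplication by \<open>r\<close> on all functionals. In this form single linear factors can be
  split off.\<close>

definition annihilates :: "complex list \<Rightarrow> 'a::comm_ring_1 \<Rightarrow> bool" where
  "annihilates cs r \<longleftrightarrow> (\<forall>f. Modules.additive f \<longrightarrow> foldr (shift r) cs f = (\<lambda>_. 0))"

text \<open>Composing shifts evaluates the product of the linear factors at the multiplication
  operator. The degree of that product makes the extra top term in the induction step
  vanish.\<close>

lemma foldr_shift_eq_sum:
  fixes r :: "'a::comm_ring_1"
  shows "foldr (shift r) cs f
    = (\<lambda>x. \<Sum>i\<le>length cs. coeff (\<Prod>c\<leftarrow>cs. [:- c, 1:]) i * f (r ^ i * x))"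
proof (induction cs)
  case Nil
  then show ?case by simp
next
  case (Cons c cs)
  let ?p = "\<Prod>c\<leftarrow>cs. [:- c, 1:]" and ?m = "length cs"
  have deg: "degree ?p = ?m"
  proof (induction cs)
    case (Cons c cs)
    have "(\<Prod>c\<leftarrow>cs. [:- c, 1:]) \<noteq> 0" by (auto simp: prod_list_zero_iff)
    then have "degree ([:- c, 1:] * (\<Prod>c\<leftarrow>cs. [:- c, 1:])) = 1 + length cs"
      using Cons by (subst degree_mult_eq) auto
    then show ?case by (simp only: list.map prod_list.Cons list.size)
  qed simp
  have "shift r c (\<lambda>x. \<Sum>i\<le>?m. coeff ?p i * f (r ^ i * x)) x
      = (\<Sum>i\<le>Suc ?m. coeff ([:- c, 1:] * ?p) i * f (r ^ i * x))" for x
  proof -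
    have split: "coeff ([:- c, 1:] * ?p) i = coeff (pCons 0 ?p) i - c * coeff ?p i" for i
      by simp
    have "(\<Sum>i\<le>Suc ?m. coeff ([:- c, 1:] * ?p) i * f (r ^ i * x))
        = (\<Sum>i\<le>Suc ?m. coeff (pCons 0 ?p) i * f (r ^ i * x))
          - (\<Sum>i\<le>Suc ?m. c * coeff ?p i * f (r ^ i * x))"
      unfolding split by (simp only: left_diff_distrib sum_subtractf)
    also have "(\<Sum>i\<le>Suc ?m. coeff (pCons 0 ?p) i * f (r ^ i * x))
        = (\<Sum>i\<le>?m. coeff ?p i * f (r ^ i * (r * x)))"
      by (subst sum.atMost_Suc_shift) (simp add: mult.assoc mult.left_commute)
    also have "(\<Sum>i\<le>Suc ?m. c * coeff ?p i * f (r ^ i * x))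
        = c * (\<Sum>i\<le>?m. coeff ?p i * f (r ^ i * x))"
      using deg by (simp add: coeff_eq_0 sum_distrib_left mult.assoc)
    finally show ?thesis by (simp add: shift_def)
  qed
  then show ?case
    by (simp add: Cons.IH fun_eq_iff del: mult_pCons_left sum.atMost_Suc)
qed

text \<open>Enough powers of \<open>r\<close> satisfy an integral relation. Its polynomial splits
  over the complex numbers, where the non-zero leading coefficient can be cancelled.\<close>

lemma order_annihilator_exists:
  assumes "is_order TYPE('a::comm_ring_1)"
  shows "\<exists>cs. annihilates cs (r::'a::comm_ring_1)"
proof -
  obtain n :: nat where n: "\<And>(S::nat set) (x::nat \<Rightarrow> 'a). finite S \<Longrightarrow> n < card S
    \<Longrightarrow> \<exists>c. (\<exists>k\<in>S. c k \<noteq> 0) \<and> (\<Sum>k\<in>S. of_int (c k) * x k) = 0"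
    using order_linear_dependence[OF assms] by blast
  obtain c :: "nat \<Rightarrow> int" where c: "\<exists>k\<in>{..n}. c k \<noteq> 0" "(\<Sum>k\<le>n. of_int (c k) * r ^ k) = 0"
    using n[of "{..n}" "\<lambda>k. r ^ k"] by auto
  define p where "p = (\<Sum>k\<le>n. monom (complex_of_int (c k)) k)"
  have coeff_p: "coeff p i = (if i \<le> n then of_int (c i) else 0)" for i
    by (auto simp: p_def coeff_sum)
  have p0: "p \<noteq> 0" using c(1) coeff_p by (metis atMost_iff coeff_0 of_int_eq_0_iff)
  then obtain M where M: "size M = degree p" "p = smult (lead_coeff p) (\<Prod>x\<in>#M. [:- x, 1:])"
    using alg_closed_imp_factorization by blast
  obtain cs where cs: "mset cs = M" using ex_mset by blast
  let ?q = "\<Prod>c\<leftarrow>cs. [:- c, 1:]"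
  have q: "p = smult (lead_coeff p) ?q"
    using M(2) cs by (metis mset_map prod_mset_prod_list)
  have len: "length cs = degree p" using M(1) cs by auto
  have deg_le: "degree p \<le> n" by (rule degree_le) (auto simp: coeff_p)
  have "foldr (shift r) cs f x = 0" if f: "Modules.additive f" for f x
  proof -
    have "lead_coeff p * foldr (shift r) cs f x
        = (\<Sum>i\<le>degree p. coeff (smult (lead_coeff p) ?q) i * f (r ^ i * x))"
      by (simp add: foldr_shift_eq_sum len sum_distrib_left mult.assoc)
    also have "\<dots> = (\<Sum>i\<le>degree p. coeff p i * f (r ^ i * x))"
      using q by simp
    also have "\<dots> = (\<Sum>i\<le>n. coeff p i * f (r ^ i * x))"
      by (intro sum.mono_neutral_left) (use deg_le in \<open>auto simp: coeff_eq_0\<close>)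
    also have "\<dots> = (\<Sum>i\<le>n. f (of_int (c i) * (r ^ i * x)))"
      by (simp add: coeff_p additive_of_int_mult[OF f])
    also have "\<dots> = f ((\<Sum>i\<le>n. of_int (c i) * r ^ i) * x)"
      by (simp add: additive.sum[OF f] sum_distrib_right mult.assoc)
    also have "\<dots> = 0" by (simp add: c(2) additive.zero[OF f])
    finally show ?thesis using p0 by simp
  qed
  then show ?thesis unfolding annihilates_def by blast
qed

section \<open>Ring homomorphisms as common eigenvectors\<close>

text \<open>Despite the name a single homomorphism may have a kernel; for a reduced order they
  separate points jointly.\<close>

definition embeddings :: "('a::comm_ring_1 \<Rightarrow> complex) set" where
  "embeddings = {\<sigma>. \<sigma> 1 = 1 \<and> (\<forall>x y. \<sigma> (x + y) = \<sigma> x + \<sigma> y) \<and> (\<forall>x y. \<sigma> (x * y) = \<sigma> x * \<sigma> y)}"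

lemma embeddings_one: "\<sigma> \<in> embeddings \<Longrightarrow> \<sigma> 1 = 1"
  and embeddings_add: "\<sigma> \<in> embeddings \<Longrightarrow> \<sigma> (x + y) = \<sigma> x + \<sigma> y"
  and embeddings_mult: "\<sigma> \<in> embeddings \<Longrightarrow> \<sigma> (x * y) = \<sigma> x * \<sigma> y"
  by (simp_all add: embeddings_def)

lemma embeddings_additive: "\<sigma> \<in> embeddings \<Longrightarrow> Modules.additive \<sigma>"
  by (simp add: Modules.additive_def embeddings_def)

lemmas embeddings_zero = additive.zero[OF embeddings_additive]
  and embeddings_diff = additive.diff[OF embeddings_additive]
  and embeddings_sum = additive.sum[OF embeddings_additive]

lemma embeddings_power: "\<sigma> \<in> embeddings \<Longrightarrow> \<sigma> (x ^ k) = \<sigma> x ^ k"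
  by (induction k) (simp_all add: embeddings_one embeddings_mult)

text \<open>Applying the factors in turn ends at 0; the last non-zero functional on the way is an
  eigenvector. Shifts commute, so every eigenvalue equation of \<open>f\<close> passes to it, which
  lets the construction be iterated.\<close>

lemma shift_eigenvector_exists:
  assumes "annihilates cs b" and "Modules.additive f" and "f \<noteq> (\<lambda>_. 0)"
  obtains \<mu> g where "Modules.additive g" "g \<noteq> (\<lambda>_. 0)" "shift b \<mu> g = (\<lambda>_. 0)"
    "\<And>z c. shift z c f = (\<lambda>_. 0) \<Longrightarrow> shift z c g = (\<lambda>_. 0)"
proof -
  have "foldr (shift b) cs f = (\<lambda>_. 0)" using assms(1,2) by (simp add: annihilates_def)
  then have "\<exists>\<mu> ds. foldr (shift b) ds f \<noteq> (\<lambda>_. 0) \<and>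
      shift b \<mu> (foldr (shift b) ds f) = (\<lambda>_. 0)"
  proof (induction cs)
    case Nil
    then show ?case using assms(3) by simp
  next
    case (Cons c cs)
    then show ?case by (cases "foldr (shift b) cs f = (\<lambda>_. 0)") auto
  qed
  then obtain \<mu> ds where "foldr (shift b) ds f \<noteq> (\<lambda>_. 0)"
    "shift b \<mu> (foldr (shift b) ds f) = (\<lambda>_. 0)" by blast
  moreover have "shift z c (foldr (shift b) ds f) = (\<lambda>_. 0)" if "shift z c f = (\<lambda>_. 0)" for z c
    using that by (simp add: shift_foldr_commute)
  ultimately show ?thesis
    using that[of "foldr (shift b) ds f" \<mu>] additive_foldr_shift[OF assms(2)] by blast
qed

lemma common_eigenvector_exists:
  assumes "\<And>b. b \<in> set bs \<Longrightarrow> \<exists>cs. annihilates cs b"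
    and "Modules.additive f" and "f \<noteq> (\<lambda>_. 0)"
  shows "\<exists>g. Modules.additive g \<and> g \<noteq> (\<lambda>_. 0) \<and> (\<forall>b\<in>set bs. \<exists>\<mu>. shift b \<mu> g = (\<lambda>_. 0)) \<and>
    (\<forall>z c. shift z c f = (\<lambda>_. 0) \<longrightarrow> shift z c g = (\<lambda>_. 0))"
  using assms
proof (induction bs arbitrary: f)
  case Nil
  then show ?case by auto
next
  case (Cons b bs)
  obtain cs where "annihilates cs b" using Cons.prems(1) by auto
  then obtain \<mu> g where g: "Modules.additive g" "g \<noteq> (\<lambda>_. 0)" "shift b \<mu> g = (\<lambda>_. 0)"
    "\<And>z c. shift z c f = (\<lambda>_. 0) \<Longrightarrow> shift z c g = (\<lambda>_. 0)"
    using shift_eigenvector_exists[OF _ Cons.prems(2,3)] by metis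
  from Cons.IH[OF _ g(1,2)] Cons.prems(1) obtain h where
    "Modules.additive h" "h \<noteq> (\<lambda>_. 0)" "\<forall>b\<in>set bs. \<exists>\<mu>. shift b \<mu> h = (\<lambda>_. 0)"
    "\<forall>z c. shift z c g = (\<lambda>_. 0) \<longrightarrow> shift z c h = (\<lambda>_. 0)"
    by auto
  then show ?case using g(3,4) by (intro exI[of _ h]) auto
qed

text \<open>A common eigenvector for the basis is one for the whole ring. Its eigenvalue depends
  additively and multiplicatively on the ring element, hence is a homomorphism, and the given
  eigenvalue at \<open>z\<close> is preserved.\<close>

lemma order_embedding_exists:
  fixes f :: "'a::comm_ring_1 \<Rightarrow> complex"
  assumes ord: "is_order TYPE('a)" and "Modules.additive f" and "f \<noteq> (\<lambda>_. 0)"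
    and "shift z c f = (\<lambda>_. 0)"
  shows "\<exists>\<sigma>\<in>embeddings. \<sigma> z = c"
proof -
  obtain n b and co :: "nat \<Rightarrow> 'a \<Rightarrow> int"
    where b: "\<And>x. x = (\<Sum>i<n. of_int (co i x) * b i)"
      and "\<And>i. Modules.additive (co i)"
    using order_basis[OF ord] by blast
  obtain g where g: "Modules.additive g" "g \<noteq> (\<lambda>_. 0)"
    and eig: "\<And>i. i < n \<Longrightarrow> \<exists>\<mu>. shift (b i) \<mu> g = (\<lambda>_. 0)" and gz: "shift z c g = (\<lambda>_. 0)"
    using common_eigenvector_exists[of "map b [0..<n]" f] order_annihilator_exists[OF ord] assms
    by auto
  obtain \<mu> where \<mu>: "\<And>i x. i < n \<Longrightarrow> g (b i * x) = \<mu> i * g x"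
  proof -
    have "\<forall>i. \<exists>m. i < n \<longrightarrow> (\<forall>x. g (b i * x) = m * g x)"
      using eig unfolding shift_def fun_eq_iff by (metis eq_iff_diff_eq_0)
    then show ?thesis using that by metis
  qed
  define \<nu> where "\<nu> = (\<lambda>r. \<Sum>i<n. of_int (co i r) * \<mu> i)"
  have \<nu>: "g (r * x) = \<nu> r * g x" for r x
  proof -
    have "g (r * x) = g (\<Sum>i<n. of_int (co i r) * (b i * x))"
      by (subst b[of r]) (simp add: sum_distrib_right mult.assoc)
    also have "\<dots> = (\<Sum>i<n. of_int (co i r) * (\<mu> i * g x))"
      by (simp add: additive.sum[OF g(1)] additive_of_int_mult[OF g(1)] \<mu>)
    finally show ?thesis by (simp add: \<nu>_def sum_distrib_right mult.assoc)
  qed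
  have g1: "g 1 \<noteq> 0"
  proof
    assume "g 1 = 0"
    then have "g = (\<lambda>_. 0)" using \<nu>[of _ 1] by auto
    with g(2) show False by simp
  qed
  have \<nu>_eq: "\<nu> r = g r / g 1" for r using \<nu>[of r 1] g1 by simp
  have "\<nu> \<in> embeddings"
    unfolding embeddings_def
  proof (intro CollectI conjI allI)
    show "\<nu> 1 = 1" using g1 by (simp add: \<nu>_eq)
    show "\<nu> (x + y) = \<nu> x + \<nu> y" for x y
      by (simp add: \<nu>_eq additive.add[OF g(1)] add_divide_distrib)
    show "\<nu> (x * y) = \<nu> x * \<nu> y" for x y
      by (simp add: \<nu>_eq[of "x * y"] \<nu>) (simp add: \<nu>_eq)
  qed
  moreover have "\<nu> z = c"
    using gz g1 \<nu>[of z 1] by (auto simp: shift_def fun_eq_iff dest: spec[of _ 1])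
  ultimately show ?thesis by blast
qed

text \<open>A homomorphism is determined by its values on the basis, and each value is among the
  finitely many roots in an annihilating list.\<close>

lemma order_finite_embeddings:
  assumes ord: "is_order TYPE('a::comm_ring_1)"
  shows "finite (embeddings :: ('a::comm_ring_1 \<Rightarrow> complex) set)"
proof -
  obtain n b and co :: "nat \<Rightarrow> 'a \<Rightarrow> int"
    where b: "\<And>x. x = (\<Sum>i<n. of_int (co i x) * b i)"
      and "\<And>i. Modules.additive (co i)"
    using order_basis[OF ord] by blast
  define cs where "cs = (\<lambda>i. SOME cs. annihilates cs (b i))"
  have cs: "annihilates (cs i) (b i)" for i
    unfolding cs_def by (rule someI_ex[OF order_annihilator_exists[OF ord]])
  \<comment> \<open>\<open>\<sigma>\<close> is itself an eigenvector: the shift by \<open>e\<close>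
    multiplies it by \<open>\<sigma> r - e\<close>, and evaluation at 1 shows that one of these
    factors is zero.\<close>
  have root: "\<sigma> r \<in> set ds" if \<sigma>: "\<sigma> \<in> embeddings" and ds: "annihilates ds r" for \<sigma> ds and r :: 'a
  proof -
    have "foldr (shift r) es \<sigma> = (\<lambda>x. (\<Prod>e\<leftarrow>es. \<sigma> r - e) * \<sigma> x)" for es
      by (induction es) (auto simp: shift_def embeddings_mult[OF \<sigma>] algebra_simps)
    then have "(\<Prod>e\<leftarrow>ds. \<sigma> r - e) * \<sigma> 1 = 0"
      using ds embeddings_additive[OF \<sigma>] unfolding annihilates_def by metis
    then show ?thesis by (auto simp: embeddings_one[OF \<sigma>] prod_list_zero_iff)
  qed
  let ?r = "\<lambda>\<sigma>. restrict (\<lambda>i. \<sigma> (b i)) {..<n}"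
  have "?r ` embeddings \<subseteq> PiE {..<n} (\<lambda>i. set (cs i))"
    using root cs by (auto split: if_splits)
  then have "finite (?r ` embeddings)"
    by (rule finite_subset) (auto intro: finite_PiE)
  moreover have "inj_on ?r embeddings"
  proof (rule inj_onI, rule ext)
    fix \<sigma> \<tau> :: "'a \<Rightarrow> complex" and x
    assume \<sigma>: "\<sigma> \<in> embeddings" and \<tau>: "\<tau> \<in> embeddings" and eq: "?r \<sigma> = ?r \<tau>"
    have *: "\<sigma> (b i) = \<tau> (b i)" if "i < n" for i
      using fun_cong[OF eq, of i] that by simp
    have expand: "\<rho> x = (\<Sum>i<n. of_int (co i x) * \<rho> (b i))" if "\<rho> \<in> embeddings" for \<rho>
      by (subst b[of x])
        (simp add: embeddings_sum[OF that] additive_of_int_mult[OF embeddings_additive[OF that]])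
    show "\<sigma> x = \<tau> x"
      unfolding expand[OF \<sigma>] expand[OF \<tau>] by (intro sum.cong) (auto simp: *)
  qed
  ultimately show ?thesis by (rule finite_imageD)
qed

section \<open>Elements that are small under all homomorphisms\<close>

lemma contracting_recurrence_tendsto_0:
  fixes a :: "nat \<Rightarrow> complex"
  assumes "(\<lambda>k. a (Suc k) - c * a k) \<longlonglongrightarrow> 0" and c: "cmod c < 1"
  shows "a \<longlonglongrightarrow> 0"
proof (rule LIMSEQ_I)
  fix e :: real
  assume e: "0 < e"
  \<comment> \<open>With this choice \<open>e / 2\<close> is the fixed point of
    \<open>\<lambda>t. ?d + cmod c * t\<close>, so the errors do not accumulate in
    \<open>bound\<close>.\<close>
  let ?d = "e / 2 * (1 - cmod c)"
  have "?d > 0" using e c by simp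
  then obtain K where K: "\<And>k. k \<ge> K \<Longrightarrow> cmod (a (Suc k) - c * a k) < ?d"
    using LIMSEQ_D[OF assms(1), of ?d] by auto
  have bound: "cmod (a (K + j)) \<le> e / 2 + cmod c ^ j * cmod (a K)" for j
  proof (induction j)
    case 0
    then show ?case using e by simp
  next
    case (Suc j)
    have "cmod (a (K + Suc j)) \<le> cmod (a (Suc (K + j)) - c * a (K + j)) + cmod (c * a (K + j))"
      using norm_triangle_ineq[of "a (Suc (K + j)) - c * a (K + j)" "c * a (K + j)"] by simp
    also have "\<dots> \<le> ?d + cmod c * (e / 2 + cmod c ^ j * cmod (a K))"
      using K[of "K + j"] Suc by (intro add_mono) (auto simp: norm_mult intro: mult_left_mono)
    also have "\<dots> = e / 2 + cmod c ^ Suc j * cmod (a K)" by (simp add: field_simps)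
    finally show ?case .
  qed
  have "(\<lambda>j. cmod c ^ j * cmod (a K)) \<longlonglongrightarrow> 0"
    using c by (intro tendsto_mult_left_zero LIMSEQ_realpow_zero) auto
  then obtain J where J: "\<And>j. j \<ge> J \<Longrightarrow> cmod c ^ j * cmod (a K) < e / 2"
    using LIMSEQ_D[of _ 0 "e / 2"] e by fastforce
  have "cmod (a k - 0) < e" if "k \<ge> K + J" for k
    using bound[of "k - K"] J[of "k - K"] that by (simp add: le_diff_conv2)
  then show "\<exists>no. \<forall>k\<ge>no. cmod (a k - 0) < e" by blast
qed

text \<open>Along the powers of \<open>z\<close> one shift reads \<open>a (Suc k) - c * a k\<close>,
  so the contracting recurrence strips the roots off one at a time.\<close>

lemma tendsto_0_of_foldr_shift:
  assumes "\<And>c. c \<in> set cs \<Longrightarrow> cmod c < 1"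
    and "(\<lambda>k. foldr (shift z) cs f (z ^ k * x)) \<longlonglongrightarrow> 0"
  shows "(\<lambda>k. f (z ^ k * x)) \<longlonglongrightarrow> 0"
  using assms
proof (induction cs)
  case Nil
  then show ?case by simp
next
  case (Cons c cs)
  have "(\<lambda>k. foldr (shift z) cs f (z ^ k * x)) \<longlonglongrightarrow> 0"
    by (rule contracting_recurrence_tendsto_0[of _ c])
      (use Cons.prems in \<open>simp_all add: shift_def[of z c] mult.assoc\<close>)
  then show ?case using Cons by simp
qed

text \<open>The roots of a shortest annihilating list are values of ring homomorphisms, so the
  coordinates of the powers of \<^term>\<open>z\<close> are integers tending to 0.\<close>
lemma reduced_order_eq_0:
  fixes z :: "'a::comm_ring_1"
  assumes ord: "is_order TYPE('a)" and red: "is_reduced TYPE('a)"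
    and small: "\<And>\<sigma>. \<sigma> \<in> embeddings \<Longrightarrow> cmod (\<sigma> z) < 1"
  shows "z = 0"
proof -
  obtain ds where "annihilates ds z" using order_annihilator_exists[OF ord] by blast
  then obtain cs where cs: "annihilates cs z"
    "\<And>ds. length ds < length cs \<Longrightarrow> \<not> annihilates ds z"
    using ex_has_least_nat[of "\<lambda>cs. annihilates cs z" ds length] by (auto simp flip: not_less)
  have lt1: "cmod c < 1" if "c \<in> set cs" for c
  proof -
    obtain xs ys where split: "cs = xs @ c # ys" using split_list[OF \<open>c \<in> set cs\<close>] by blast
    \<comment> \<open>By minimality some functional survives when \<open>c\<close> is dropped. The
      factor for \<open>c\<close> kills what is left of it, so \<open>c\<close> is an
      eigenvalue.\<close>
    have "\<not> annihilates (xs @ ys) z" using cs(2)[of "xs @ ys"] split by simp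
    then obtain f where f: "Modules.additive f" "foldr (shift z) (xs @ ys) f \<noteq> (\<lambda>_. 0)"
      unfolding annihilates_def by blast
    have "shift z c (foldr (shift z) (xs @ ys) f) = foldr (shift z) cs f"
      by (simp add: split shift_foldr_commute)
    also have "\<dots> = (\<lambda>_. 0)" using cs(1) f(1) by (simp add: annihilates_def)
    finally obtain \<sigma> :: "'a \<Rightarrow> complex" where "\<sigma> \<in> embeddings" "\<sigma> z = c"
      using order_embedding_exists[OF ord additive_foldr_shift[OF f(1)] f(2)] by blast
    then show ?thesis using small by blast
  qed
  obtain n b and co :: "nat \<Rightarrow> 'a \<Rightarrow> int"
    where b: "\<And>x. x = (\<Sum>i<n. of_int (co i x) * b i)"
      and co: "\<And>i. Modules.additive (co i)"
    using order_basis[OF ord] by blast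
  have "\<forall>\<^sub>F k in sequentially. co i (z ^ k) = 0" for i
  proof -
    let ?f = "\<lambda>x. complex_of_int (co i x)"
    have "Modules.additive ?f" using co[of i] by (simp add: Modules.additive_def)
    then have "foldr (shift z) cs ?f = (\<lambda>_. 0)" using cs(1) by (simp add: annihilates_def)
    then have "(\<lambda>k. ?f (z ^ k * 1)) \<longlonglongrightarrow> 0"
      by (intro tendsto_0_of_foldr_shift[of cs] lt1) auto
    then have "\<forall>\<^sub>F k in sequentially. dist (?f (z ^ k * 1)) 0 < 1"
      by (rule tendstoD) simp
    then show ?thesis
      by eventually_elim (simp add: dist_norm flip: of_int_abs)
  qed
  then have "\<forall>\<^sub>F k in sequentially. \<forall>i\<in>{..<n}. co i (z ^ k) = 0"
    by (intro eventually_ball_finite) auto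
  then obtain k where k: "\<forall>i\<in>{..<n}. co i (z ^ k) = 0"
    unfolding eventually_sequentially by blast
  have "z ^ k = 0" by (subst b) (use k in simp)
  then show ?thesis using red unfolding is_reduced_def by blast
qed

text \<open>An integral relation among many elements of \<open>G\<close> has coefficients in
  \<open>A\<close>, so the kernel condition makes them zero in the ring, against
  torsion-freeness.\<close>

lemma order_finite_of_group_ring_eq:
  assumes ord: "is_order TYPE('a::comm_ring_1)" and A: "subring A"
    and AG: "group_ring_eq A (G::'a::comm_ring_1 set) UNIV"
  shows "finite G"
proof (rule ccontr)
  assume "infinite G"
  obtain n :: nat where n: "\<And>(S::'a set) (x::'a \<Rightarrow> 'a). finite S \<Longrightarrow> n < card S
    \<Longrightarrow> \<exists>c. (\<exists>k\<in>S. c k \<noteq> 0) \<and> (\<Sum>k\<in>S. of_int (c k) * x k) = 0"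
    using order_linear_dependence[OF ord] by blast
  obtain S where S: "finite S" "card S = Suc n" "S \<subseteq> G"
    using infinite_arbitrarily_large[OF \<open>infinite G\<close>] by blast
  obtain c k where c: "k \<in> S" "c k \<noteq> 0" "(\<Sum>k\<in>S. of_int (c k) * k) = 0"
    using n[OF S(1), of id] S(2) by auto
  have zero: "0 \<in> A" using A unfolding subring_def by (metis diff_self)
  have nat: "of_nat m \<in> A" for m
    using A zero by (induction m) (auto simp: subring_def)
  have int: "of_int m \<in> A" for m
  proof (cases m)
    case (neg k)
    have "0 - of_nat (Suc k) \<in> A" using A zero nat unfolding subring_def by blast
    then show ?thesis using neg by simp
  qed (simp add: nat)
  have "\<forall>k\<in>S. of_int (c k) = (0::'a)"
    using AG S(1,3) c(3) int unfolding group_ring_eq_def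
    by (elim conjE allE[of _ S] allE[of _ "\<lambda>k. of_int (c k)"]) auto
  then show False
    using order_torsion_free[OF ord, of "c k" "1::'a"] c(1,2) by auto
qed

section \<open>Group rings as gradings\<close>

text \<open>Determined only at units, where the inverse is unique.\<close>

definition unit_inv :: "'a::comm_ring_1 \<Rightarrow> 'a" where
  "unit_inv u = (THE v. u * v = 1)"

lemma unit_inv_eq: "u * v = 1 \<Longrightarrow> unit_inv u = v"
  unfolding unit_inv_def by (rule the_equality) (metis mult.assoc mult.commute mult_1)+

lemma finite_unit_subgroup_torsion:
  assumes "finite G" and G: "unit_subgroup G UNIV" and "g \<in> G"
  shows "\<exists>k>0. g ^ k = 1"
proof -
  have pow: "g ^ i \<in> G" for i
    using G \<open>g \<in> G\<close> by (induction i) (auto simp: unit_subgroup_def)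
  then have "\<not> inj (\<lambda>i::nat. g ^ i)"
    using \<open>finite G\<close> finite_subset[of "range (\<lambda>i::nat. g ^ i)" G]
    by (auto dest: finite_imageD)
  then obtain i j where ij: "i < j" "g ^ i = g ^ j"
    unfolding inj_def by (metis nat_neq_iff)
  obtain h where h: "g ^ i * h = 1" using G pow unfolding unit_subgroup_def by blast
  have "g ^ (j - i) = (g ^ i * h) * g ^ (j - i)" by (simp add: h)
  also have "\<dots> = g ^ j * h" using ij(1) by (simp add: mult_ac flip: power_add)
  also have "\<dots> = 1" using ij(2) h by simp
  finally show ?thesis using ij(1) by (intro exI[of _ "j - i"]) simp
qed

locale group_ring =
  fixes A G :: "'a::comm_ring_1 set"
  assumes A: "subring A" and G: "unit_subgroup G UNIV"
    and AG: "group_ring_eq A G UNIV" and finite_G: "finite G"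
begin

lemma A_one: "1 \<in> A" and A_add: "x \<in> A \<Longrightarrow> y \<in> A \<Longrightarrow> x + y \<in> A"
  and A_diff: "x \<in> A \<Longrightarrow> y \<in> A \<Longrightarrow> x - y \<in> A"
  and A_mult: "x \<in> A \<Longrightarrow> y \<in> A \<Longrightarrow> x * y \<in> A"
  using A by (auto simp: subring_def)

lemma A_zero: "0 \<in> A" using A_diff[OF A_one A_one] by simp

lemma G_one: "1 \<in> G" and G_mult: "g \<in> G \<Longrightarrow> h \<in> G \<Longrightarrow> g * h \<in> G"
  using G by (auto simp: unit_subgroup_def)

lemma G_inv: assumes "g \<in> G" shows "unit_inv g \<in> G" "g * unit_inv g = 1" "unit_inv g * g = 1"
proof -
  obtain h where h: "h \<in> G" "g * h = 1" using G assms unfolding unit_subgroup_def by blast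
  with unit_inv_eq[OF h(2)] show "unit_inv g \<in> G" "g * unit_inv g = 1" "unit_inv g * g = 1"
    by (auto simp: mult.commute)
qed

lemma G_inv_inv: "g \<in> G \<Longrightarrow> unit_inv (unit_inv g) = g"
  using G_inv by (intro unit_inv_eq)

lemma G_cancel: "g \<in> G \<Longrightarrow> x * g = y * g \<Longrightarrow> x = y"
  using G_inv(2) by (metis mult.assoc mult.right_neutral)

lemma G_torsion: "g \<in> G \<Longrightarrow> \<exists>k>0. g ^ k = 1"
  by (rule finite_unit_subgroup_torsion[OF finite_G G])

text \<open>The homogeneous part of degree \<open>g\<close> in the grading of the ring by
  \<open>G\<close>.\<close>

definition piece :: "'a \<Rightarrow> 'a set" where
  "piece g = (\<lambda>a. a * g) ` A"

lemma pieceI: "a \<in> A \<Longrightarrow> x = a * g \<Longrightarrow> x \<in> piece g"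
  by (auto simp: piece_def)

lemma piece_one: "piece 1 = A" by (simp add: piece_def)

lemma piece_self: "g \<in> piece g" by (rule pieceI[OF A_one]) simp

lemma piece_zero: "0 \<in> piece g" by (rule pieceI[OF A_zero]) simp

lemma piece_add: "x \<in> piece g \<Longrightarrow> y \<in> piece g \<Longrightarrow> x + y \<in> piece g"
  by (auto simp: piece_def intro!: image_eqI[OF _ A_add] simp: distrib_right)

lemma piece_diff: "x \<in> piece g \<Longrightarrow> y \<in> piece g \<Longrightarrow> x - y \<in> piece g"
  by (auto simp: piece_def intro!: image_eqI[OF _ A_diff] simp: left_diff_distrib)

lemma piece_mult: "x \<in> piece g \<Longrightarrow> y \<in> piece h \<Longrightarrow> x * y \<in> piece (g * h)"
proof -
  assume "x \<in> piece g" "y \<in> piece h"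
  then obtain a b where "a \<in> A" "b \<in> A" "x = a * g" "y = b * h" unfolding piece_def by blast
  then show ?thesis by (intro pieceI[of "a * b"] A_mult) (simp_all add: mult_ac)
qed

lemma piece_decomposition_exists: "\<exists>y. (\<forall>g\<in>G. y g \<in> piece g) \<and> x = (\<Sum>g\<in>G. y g)"
proof -
  have "x \<in> {(\<Sum>g\<in>F. f g * g) | F f. finite F \<and> F \<subseteq> G \<and> f ` F \<subseteq> A}"
    using AG unfolding group_ring_eq_def by blast
  then obtain F f where F: "F \<subseteq> G" "f ` F \<subseteq> A" "x = (\<Sum>g\<in>F. f g * g)" by auto
  have "x = (\<Sum>g\<in>G. if g \<in> F then f g * g else 0)"
    using F(1) by (simp add: F(3) sum.inter_restrict[OF finite_G, symmetric] Int_absorb1)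
  with F show ?thesis
    by (intro exI[of _ "\<lambda>g. if g \<in> F then f g * g else 0"])
      (auto intro: pieceI piece_zero)
qed

lemma piece_independent:
  assumes "\<And>g. g \<in> G \<Longrightarrow> y g \<in> piece g" and "(\<Sum>g\<in>G. y g) = 0" and "g \<in> G"
  shows "y g = 0"
proof -
  obtain f where f: "\<And>g. g \<in> G \<Longrightarrow> f g \<in> A" "\<And>g. g \<in> G \<Longrightarrow> y g = f g * g"
    using assms(1) unfolding piece_def image_iff by metis
  have "(\<Sum>g\<in>G. f g * g) = 0" using assms(2) f(2) by simp
  then have "\<forall>g\<in>G. f g = 0"
    using AG finite_G f(1) unfolding group_ring_eq_def by blast
  then show ?thesis using f(2) assms(3) by simp
qed

text \<open>The projection onto degree \<open>g\<close>. The value 0 off \<open>G\<close> makes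
  additivity and membership in \<open>piece g\<close> hold for every \<open>g\<close>.\<close>

definition component :: "'a \<Rightarrow> 'a \<Rightarrow> 'a" where
  "component g x = (if g \<in> G
     then (SOME y. (\<forall>g\<in>G. y g \<in> piece g) \<and> x = (\<Sum>g\<in>G. y g)) g else 0)"

lemma component_outside: "g \<notin> G \<Longrightarrow> component g x = 0"
  by (simp add: component_def)

lemma component_piece: "component g x \<in> piece g" and sum_component: "(\<Sum>g\<in>G. component g x) = x"
  using someI_ex[OF piece_decomposition_exists[of x]] by (auto simp: component_def piece_zero)

lemma component_unique:
  assumes "\<And>g. g \<in> G \<Longrightarrow> y g \<in> piece g" and "x = (\<Sum>g\<in>G. y g)" and "g \<in> G"
  shows "component g x = y g"
  using piece_independent[of "\<lambda>g. component g x - y g"] assms sum_component[of x]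
  by (simp add: piece_diff component_piece sum_subtractf)

lemma component_add: "component g (x + y) = component g x + component g y"
proof (cases "g \<in> G")
  case True
  show ?thesis
    by (rule component_unique[OF _ _ True, of "\<lambda>g. component g x + component g y"])
      (simp_all add: piece_add component_piece sum.distrib sum_component)
qed (simp add: component_outside)

lemma component_additive: "Modules.additive (component g)"
  by unfold_locales (rule component_add)

lemmas component_sum = additive.sum[OF component_additive]
  and component_zero = additive.zero[OF component_additive]
  and component_diff = additive.diff[OF component_additive]

lemma component_of_piece:
  assumes "x \<in> piece k" and "k \<in> G"
  shows "component g x = (if g = k then x else 0)"
proof (cases "g \<in> G")
  case True
  show ?thesis
    by (rule component_unique[OF _ _ True]) (use assms finite_G in \<open>auto simp: piece_zero\<close>)
qed (use assms component_outside in auto)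

lemma piece_unique: "x \<in> piece g \<Longrightarrow> x \<in> piece h \<Longrightarrow> g \<in> G \<Longrightarrow> h \<in> G \<Longrightarrow> x \<noteq> 0 \<Longrightarrow> g = h"
  using component_of_piece[of x g g] component_of_piece[of x h g] by (auto split: if_splits)

lemma mult_eq_sum_component: "x * y = (\<Sum>g\<in>G. \<Sum>h\<in>G. component g x * component h y)"
  by (simp flip: sum_product add: sum_component)

lemma sum_G_mult_inv: "(\<Sum>g\<in>G. f (unit_inv g)) = (\<Sum>g\<in>G. f g)"
  by (rule sum.reindex_bij_witness[of _ unit_inv unit_inv]) (auto simp: G_inv G_inv_inv)

lemma unit_mult_eq_1_iff: "g \<in> G \<Longrightarrow> g * h = 1 \<longleftrightarrow> h = unit_inv g"
  using unit_inv_eq G_inv(2) by blast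

lemma component_one_one: "component 1 1 = 1"
  by (simp add: component_of_piece[OF piece_self G_one])

end

section \<open>The canonical inner product\<close>

definition inner :: "'a::comm_ring_1 \<Rightarrow> 'a \<Rightarrow> complex" where
  "inner x y = (\<Sum>\<sigma>\<in>embeddings. \<sigma> x * cnj (\<sigma> y))"

definition sqnorm :: "'a::comm_ring_1 \<Rightarrow> real" where
  "sqnorm x = (\<Sum>\<sigma>\<in>embeddings. (cmod (\<sigma> x))\<^sup>2)"

lemma sqnorm_eq_inner: "complex_of_real (sqnorm x) = inner x x"
  by (simp add: sqnorm_def inner_def complex_norm_square del: of_real_power)

lemma sqnorm_nonneg: "sqnorm x \<ge> 0"
  by (simp add: sqnorm_def sum_nonneg)

lemma sqnorm_zero: "sqnorm 0 = 0"
  by (simp add: sqnorm_def embeddings_zero)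

lemma inner_sum_left: "inner (sum f I) y = (\<Sum>i\<in>I. inner (f i) y)"
proof -
  have "inner (sum f I) y = (\<Sum>\<sigma>\<in>embeddings. \<Sum>i\<in>I. \<sigma> (f i) * cnj (\<sigma> y))"
    unfolding inner_def by (intro sum.cong refl) (simp add: embeddings_sum sum_distrib_right)
  also have "\<dots> = (\<Sum>i\<in>I. inner (f i) y)" unfolding inner_def by (rule sum.swap)
  finally show ?thesis .
qed

lemma inner_commute: "inner x y = cnj (inner y x)"
  by (simp add: inner_def mult.commute)

lemma inner_sum_right: "inner x (sum f I) = (\<Sum>i\<in>I. inner x (f i))"
  by (subst (1 2) inner_commute) (simp add: inner_sum_left)

lemma embeddings_torsion:
  assumes "\<sigma> \<in> embeddings" and "u ^ k = 1" and "k > 0"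
  shows "cmod (\<sigma> u) = 1"
proof -
  have "cmod (\<sigma> u) ^ k = 1"
    using assms by (metis embeddings_one embeddings_power norm_one norm_power)
  then show ?thesis using assms(3) power_eq_imp_eq_base[of "cmod (\<sigma> u)" k 1] by simp
qed

lemma embeddings_torsion_inverse:
  assumes "\<sigma> \<in> embeddings" and "u ^ k = 1" and "k > 0" and "u * v = 1"
  shows "\<sigma> v = cnj (\<sigma> u)"
proof -
  have "\<sigma> u * \<sigma> v = 1"
    using assms by (metis embeddings_one embeddings_mult)
  moreover have "\<sigma> u * cnj (\<sigma> u) = 1"
    using embeddings_torsion[OF assms(1-3)] by (simp add: complex_norm_square[symmetric])
  ultimately show ?thesis by (metis mult.assoc mult.commute mult_1)
qed

section \<open>Twisting homomorphisms by characters, and orthogonality of the pieces\<close>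

text \<open>Isolates what the later arguments take from a reduced order: finiteness of the set of
  homomorphisms, and a lower bound for non-zero elements.\<close>

locale embedded_group_ring = group_ring +
  assumes finite_embeddings: "finite (embeddings :: ('a \<Rightarrow> complex) set)"
    and eq_0_if_small: "\<And>z::'a. (\<And>\<sigma>. \<sigma> \<in> embeddings \<Longrightarrow> cmod (\<sigma> z) < 1) \<Longrightarrow> z = 0"
begin

lemma embeddings_separate: "(\<And>\<sigma>. \<sigma> \<in> embeddings \<Longrightarrow> \<sigma> (x::'a) = \<sigma> y) \<Longrightarrow> x = y"
proof -
  assume eq: "\<And>\<sigma>. \<sigma> \<in> embeddings \<Longrightarrow> \<sigma> x = \<sigma> y"
  have "x - y = 0"
  proof (rule eq_0_if_small)
    fix \<sigma> :: "'a \<Rightarrow> complex" assume "\<sigma> \<in> embeddings"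
    then show "cmod (\<sigma> (x - y)) < 1" using eq[of \<sigma>] by (simp add: embeddings_diff)
  qed
  then show ?thesis by simp
qed

lemma sqnorm_ge_1: "sqnorm (x::'a) \<ge> 1" if "x \<noteq> 0"
proof -
  obtain \<sigma> :: "'a \<Rightarrow> complex" where \<sigma>: "\<sigma> \<in> embeddings" "cmod (\<sigma> x) \<ge> 1"
    using eq_0_if_small[of x] \<open>x \<noteq> 0\<close> by force
  have "1 \<le> (cmod (\<sigma> x))\<^sup>2" using \<sigma>(2) by simp
  also have "\<dots> \<le> sqnorm x" unfolding sqnorm_def
    by (rule member_le_sum[OF \<sigma>(1)]) (simp_all add: finite_embeddings)
  finally show ?thesis .
qed

lemma G_unimodular: "\<sigma> \<in> embeddings \<Longrightarrow> g \<in> G \<Longrightarrow> cmod (\<sigma> g) = 1"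
  using G_torsion embeddings_torsion by blast

lemma G_embeddings_inv: "\<sigma> \<in> embeddings \<Longrightarrow> g \<in> G \<Longrightarrow> \<sigma> (unit_inv g) = cnj (\<sigma> g)"
  using G_torsion embeddings_torsion_inverse G_inv(2) by blast

text \<open>The restriction of \<open>\<tau>\<close> to \<open>G\<close> acts on
  \<open>\<sigma>\<close> as a character of \<open>G\<close>. Such characters separate the elements
  of \<open>G\<close>, because the homomorphisms separate points.\<close>

definition twist :: "('a \<Rightarrow> complex) \<Rightarrow> ('a \<Rightarrow> complex) \<Rightarrow> 'a \<Rightarrow> complex" where
  "twist \<tau> \<sigma> x = (\<Sum>g\<in>G. \<tau> g * \<sigma> (component g x))"

lemma twist_piece:
  assumes "\<sigma> \<in> embeddings" "x \<in> piece g" "g \<in> G"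
  shows "twist \<tau> \<sigma> x = \<tau> g * \<sigma> x"
proof -
  have "twist \<tau> \<sigma> x = (\<Sum>h\<in>G. if h = g then \<tau> g * \<sigma> x else 0)"
    unfolding twist_def using assms
    by (intro sum.cong) (auto simp: component_of_piece embeddings_zero)
  then show ?thesis using assms(3) finite_G by simp
qed

lemma twist_embedding:
  assumes \<tau>: "\<tau> \<in> embeddings" and \<sigma>: "\<sigma> \<in> embeddings"
  shows "twist \<tau> \<sigma> \<in> embeddings"
  unfolding embeddings_def
proof (intro CollectI conjI allI)
  have add: "twist \<tau> \<sigma> (x + y) = twist \<tau> \<sigma> x + twist \<tau> \<sigma> y" for x y
    by (simp add: twist_def component_add embeddings_add[OF \<sigma>] distrib_left sum.distrib)
  then show "twist \<tau> \<sigma> (x + y) = twist \<tau> \<sigma> x + twist \<tau> \<sigma> y" for x y .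
  then interpret additive "twist \<tau> \<sigma>" by unfold_locales
  show "twist \<tau> \<sigma> 1 = 1"
    by (subst twist_piece[OF \<sigma> piece_self G_one]) (simp add: embeddings_one \<tau> \<sigma>)
  show "twist \<tau> \<sigma> (x * y) = twist \<tau> \<sigma> x * twist \<tau> \<sigma> y" for x y
  proof -
    have "twist \<tau> \<sigma> (x * y) = (\<Sum>g\<in>G. \<Sum>h\<in>G. twist \<tau> \<sigma> (component g x * component h y))"
      by (subst mult_eq_sum_component) (simp add: sum)
    also have "\<dots> = (\<Sum>g\<in>G. \<Sum>h\<in>G. \<tau> g * \<sigma> (component g x) * (\<tau> h * \<sigma> (component h y)))"
      by (intro sum.cong refl, subst twist_piece[OF \<sigma> piece_mult[OF component_piece component_piece]])
        (simp_all add: G_mult embeddings_mult \<sigma> \<tau>)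
    also have "\<dots> = twist \<tau> \<sigma> x * twist \<tau> \<sigma> y"
      by (simp add: twist_def sum_product)
    finally show ?thesis .
  qed
qed

text \<open>As \<open>\<tau>\<close> has no zero on \<open>G\<close>, the twist determines
  \<open>\<sigma>\<close> on every piece; an injective self-map of a finite set is
  bijective.\<close>

lemma bij_betw_twist:
  assumes \<tau>: "\<tau> \<in> embeddings"
  shows "bij_betw (twist \<tau>) embeddings embeddings"
proof -
  have "inj_on (twist \<tau>) embeddings"
  proof (rule inj_onI, rule ext)
    fix \<sigma> \<rho> x
    assume \<sigma>: "\<sigma> \<in> embeddings" and \<rho>: "\<rho> \<in> embeddings" and eq: "twist \<tau> \<sigma> = twist \<tau> \<rho>"
    have "\<sigma> (component g x) = \<rho> (component g x)" if "g \<in> G" for g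
    proof -
      have "\<tau> g * \<sigma> (component g x) = \<tau> g * \<rho> (component g x)"
        using twist_piece[OF \<sigma> component_piece that, of \<tau> x] twist_piece[OF \<rho> component_piece that, of \<tau> x]
        unfolding eq by (rule trans[OF sym])
      moreover have "\<tau> g \<noteq> 0" using G_unimodular[OF \<tau> that] by auto
      ultimately show ?thesis by simp
    qed
    then have "\<sigma> (\<Sum>g\<in>G. component g x) = \<rho> (\<Sum>g\<in>G. component g x)"
      by (simp add: embeddings_sum \<sigma> \<rho>)
    then show "\<sigma> x = \<rho> x" by (simp add: sum_component)
  qed
  moreover have "twist \<tau> ` embeddings \<subseteq> embeddings" using twist_embedding[OF \<tau>] by blast
  ultimately show ?thesis
    using endo_inj_surj[OF finite_embeddings] by (simp add: bij_betw_def)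
qed

text \<open>Reindexing the sum by a twist multiplies it by \<open>\<tau> g * cnj (\<tau> h)\<close>.
  Both values have modulus 1, so this factor differs from 1 when \<open>\<tau>\<close> separates
  \<open>g\<close> and \<open>h\<close>.\<close>

lemma piece_orthogonal:
  assumes x: "x \<in> piece g" and y: "y \<in> piece h" and "g \<in> G" "h \<in> G" "g \<noteq> h"
  shows "inner x y = 0"
proof -
  obtain \<tau> :: "'a \<Rightarrow> complex" where \<tau>: "\<tau> \<in> embeddings" "\<tau> g \<noteq> \<tau> h"
    using embeddings_separate[of g h] assms(5) by blast
  have "inner x y = (\<Sum>\<sigma>\<in>embeddings. twist \<tau> \<sigma> x * cnj (twist \<tau> \<sigma> y))"
    unfolding inner_def by (rule sum.reindex_bij_betw[OF bij_betw_twist[OF \<tau>(1)], symmetric])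
  also have "\<dots> = (\<Sum>\<sigma>\<in>embeddings. \<tau> g * cnj (\<tau> h) * (\<sigma> x * cnj (\<sigma> y)))"
    by (intro sum.cong) (simp_all add: twist_piece[OF _ x] twist_piece[OF _ y] assms)
  also have "\<dots> = \<tau> g * cnj (\<tau> h) * inner x y"
    by (simp add: inner_def sum_distrib_left)
  finally have "(\<tau> g * cnj (\<tau> h) - 1) * inner x y = 0" by (simp add: algebra_simps)
  moreover have "\<tau> g * cnj (\<tau> h) \<noteq> 1"
  proof
    assume "\<tau> g * cnj (\<tau> h) = 1"
    then have "\<tau> g * (cnj (\<tau> h) * \<tau> h) = \<tau> h" by (simp flip: mult.assoc)
    moreover have "cnj (\<tau> h) * \<tau> h = 1"
      using G_unimodular[OF \<tau>(1) \<open>h \<in> G\<close>]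
      by (simp add: complex_norm_square[symmetric] mult.commute)
    ultimately show False using \<tau>(2) by simp
  qed
  ultimately show ?thesis by simp
qed

lemma sqnorm_component: "sqnorm x = (\<Sum>g\<in>G. sqnorm (component g x))"
proof -
  have "inner x x = inner (\<Sum>g\<in>G. component g x) (\<Sum>h\<in>G. component h x)" by (simp add: sum_component)
  also have "\<dots> = (\<Sum>g\<in>G. \<Sum>h\<in>G. inner (component g x) (component h x))"
    by (simp only: inner_sum_left) (simp only: inner_sum_right)
  also have "\<dots> = (\<Sum>g\<in>G. \<Sum>h\<in>G. if h = g then inner (component g x) (component g x) else 0)"
    by (intro sum.cong refl) (auto intro!: piece_orthogonal component_piece)
  also have "\<dots> = complex_of_real (\<Sum>g\<in>G. sqnorm (component g x))"
    using finite_G by (simp add: sqnorm_eq_inner)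
  finally show ?thesis by (simp add: sqnorm_eq_inner[symmetric] del: of_real_sum)
qed

text \<open>The hypotheses say that \<open>x\<close> is not homogeneous, so a component at a degree
  other than \<open>k\<close> is non-zero and takes at least 1 of the squared norm.\<close>

lemma sqnorm_component_descent:
  assumes "component g x \<noteq> 0" and "component g x \<noteq> x"
  shows "sqnorm (component k x) \<le> sqnorm x - 1"
proof (cases "k \<in> G")
  case True
  have "\<exists>j\<in>G - {k}. component j x \<noteq> 0"
  proof (rule ccontr)
    assume none: "\<not> ?thesis"
    have "x = component k x + (\<Sum>j\<in>G - {k}. component j x)"
      using sum_component[of x] sum.remove[OF finite_G True, of "\<lambda>g. component g x"] by simp
    also have "\<dots> = component k x" using none by simp
    finally show False using assms none component_outside[of g x] by (cases "g = k") auto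
  qed
  then obtain j where j: "j \<in> G" "j \<noteq> k" "component j x \<noteq> 0" by blast
  have "sqnorm (component k x) + sqnorm (component j x) = (\<Sum>g\<in>{k, j}. sqnorm (component g x))"
    using j by simp
  also have "\<dots> \<le> sqnorm x"
    unfolding sqnorm_component[of x] using j True
    by (intro sum_mono2) (auto simp: finite_G sqnorm_nonneg)
  finally show ?thesis using sqnorm_ge_1[OF j(3)] by simp
next
  case False
  moreover have "x \<noteq> 0" using assms(1) component_zero by auto
  ultimately show ?thesis using sqnorm_ge_1[of x] by (simp add: component_outside sqnorm_zero)
qed

section \<open>Homogeneity of torsion units\<close>

text \<open>Under every twist of \<open>\<sigma>\<close> the image of \<open>v\<close> is the
  conjugate of that of \<open>u\<close>. These are Fourier transforms over \<open>G\<close> of the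
  components, so inversion gives the identity degree by degree.\<close>

lemma torsion_unit_component_inverse:
  assumes u: "u ^ k = 1" "k > 0" "u * v = 1" and \<sigma>: "\<sigma> \<in> embeddings" and h: "h \<in> G"
  shows "\<sigma> (component (unit_inv h) v) = cnj (\<sigma> (component h u))"
proof -
  define d where "d g = \<sigma> (component g v) - cnj (\<sigma> (component (unit_inv g) u))" for g
  have fourier: "(\<Sum>g\<in>G. \<tau> g * d g) = 0" if \<tau>: "\<tau> \<in> embeddings" for \<tau>
  proof -
    have "(\<Sum>g\<in>G. \<tau> g * cnj (\<sigma> (component (unit_inv g) u)))
        = (\<Sum>g\<in>G. \<tau> (unit_inv (unit_inv g)) * cnj (\<sigma> (component (unit_inv g) u)))"
      by (intro sum.cong) (simp_all add: G_inv_inv)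
    also have "\<dots> = (\<Sum>g\<in>G. \<tau> (unit_inv g) * cnj (\<sigma> (component g u)))"
      by (rule sum_G_mult_inv)
    also have "\<dots> = cnj (twist \<tau> \<sigma> u)"
      unfolding twist_def cnj_sum by (intro sum.cong) (simp_all add: G_embeddings_inv \<tau>)
    also have "\<dots> = twist \<tau> \<sigma> v"
      by (rule embeddings_torsion_inverse[OF twist_embedding[OF \<tau> \<sigma>] u, symmetric])
    finally show ?thesis
      by (simp add: d_def right_diff_distrib sum_subtractf twist_def)
  qed
  have d0: "d h = 0" if h: "h \<in> G" for h
  proof -
    \<comment> \<open>Fourier inversion: summing \<open>\<tau> g * cnj (\<tau> h)\<close> over all
      \<open>\<tau>\<close> gives \<open>inner g h\<close>, which is zero off the diagonal and
      non-zero on it.\<close>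
    have "0 = (\<Sum>\<tau>\<in>embeddings. cnj (\<tau> h) * (\<Sum>g\<in>G. \<tau> g * d g))"
      using fourier by simp
    also have "\<dots> = (\<Sum>\<tau>\<in>embeddings. \<Sum>g\<in>G. d g * (\<tau> g * cnj (\<tau> h)))"
      by (simp add: sum_distrib_left mult_ac)
    also have "\<dots> = (\<Sum>g\<in>G. d g * inner g h)"
      by (subst sum.swap) (simp add: inner_def sum_distrib_left)
    also have "\<dots> = (\<Sum>g\<in>G. if g = h then d h * inner h h else 0)"
      using h by (intro sum.cong) (auto intro: piece_orthogonal piece_self)
    also have "\<dots> = d h * inner h h" using finite_G h by simp
    finally have "d h * complex_of_real (sqnorm h) = 0" by (simp add: sqnorm_eq_inner)
    moreover have "h \<noteq> 0" using G_inv(2)[OF h] by auto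
    ultimately show ?thesis using sqnorm_ge_1[of h] by auto
  qed
  show ?thesis using d0[OF G_inv(1)[OF h]] by (simp add: d_def G_inv_inv h)
qed

text \<open>For a torsion unit \<^term>\<open>u\<close> with components \<open>u\<^sub>g\<close>, the elements
  \<open>p\<^sub>g = u\<^sub>g (u\<^sup>-\<^sup>1)\<^bsub>g\<^sup>-\<^sup>1\<^esub>\<close> have \<open>\<sigma> p\<^sub>g = \<bar>\<sigma> u\<^sub>g\<bar>\<^sup>2\<close> and sum 1, so \<open>\<bar>\<sigma> (p\<^sub>g (1 - p\<^sub>g))\<bar> \<le> 1/4\<close> for
  all \<open>\<sigma>\<close>, which makes \<open>p\<^sub>g\<close> idempotent.\<close>
lemma torsion_unit_homogeneous:
  assumes conn: "is_connected TYPE('a)" and u: "u ^ k = 1" "k > 0"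
  shows "\<exists>g\<in>G. u \<in> piece g"
proof -
  define v where "v = u ^ (k - 1)"
  have uv: "u * v = 1" using u by (simp add: v_def flip: power_Suc)
  define p where "p g = component g u * component (unit_inv g) v" for g
  have \<sigma>_p: "\<sigma> (p g) = complex_of_real ((cmod (\<sigma> (component g u)))\<^sup>2)"
    if "\<sigma> \<in> embeddings" "g \<in> G" for \<sigma> g
    using torsion_unit_component_inverse[OF u uv that]
    by (simp add: p_def embeddings_mult[OF that(1)] complex_norm_square del: of_real_power)
  \<comment> \<open>The degree 1 component of \<open>u * v\<close> collects exactly the pairs with
    \<open>h = unit_inv g\<close>.\<close>
  have sum_p: "(\<Sum>g\<in>G. p g) = 1"
  proof -
    have "1 = component 1 (u * v)" by (simp add: uv component_one_one)
    also have "\<dots> = (\<Sum>g\<in>G. \<Sum>h\<in>G. component 1 (component g u * component h v))"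
      by (subst mult_eq_sum_component) (simp add: component_sum)
    also have "\<dots> = (\<Sum>g\<in>G. \<Sum>h\<in>G. if h = unit_inv g then p g else 0)"
      by (intro sum.cong refl, subst component_of_piece[OF piece_mult[OF component_piece component_piece]])
        (auto simp: G_mult p_def unit_mult_eq_1_iff dest: sym[of 1])
    also have "\<dots> = (\<Sum>g\<in>G. p g)"
      using finite_G G_inv(1) by simp
    finally show ?thesis by simp
  qed
  have sum_sq: "(\<Sum>g\<in>G. (cmod (\<sigma> (component g u)))\<^sup>2) = 1" if "\<sigma> \<in> embeddings" for \<sigma>
  proof -
    have "complex_of_real (\<Sum>g\<in>G. (cmod (\<sigma> (component g u)))\<^sup>2) = \<sigma> (\<Sum>g\<in>G. p g)"
      using \<sigma>_p[OF that] by (simp add: embeddings_sum[OF that] del: of_real_power)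
    also have "\<dots> = complex_of_real 1" by (simp add: sum_p embeddings_one that)
    finally show ?thesis by (simp only: of_real_eq_iff)
  qed
  have p01: "p g = 0 \<or> p g = 1" if g: "g \<in> G" for g
  proof -
    have "p g * (1 - p g) = 0"
    proof (rule eq_0_if_small)
      fix \<sigma> :: "'a \<Rightarrow> complex" assume \<sigma>: "\<sigma> \<in> embeddings"
      define t where "t = (cmod (\<sigma> (component g u)))\<^sup>2"
      have t: "0 \<le> t" "t \<le> 1"
        using sum_sq[OF \<sigma>] member_le_sum[OF g, of "\<lambda>g. (cmod (\<sigma> (component g u)))\<^sup>2"]
        by (auto simp: finite_G t_def)
      have "\<sigma> (p g * (1 - p g)) = complex_of_real (t * (1 - t))"
        using \<sigma>_p[OF \<sigma> g]
        by (simp add: embeddings_mult embeddings_diff embeddings_one \<sigma> t_def)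
      moreover have "\<bar>t * (1 - t)\<bar> < 1"
      proof -
        have "t * (1 - t) = 1 / 4 - (t - 1 / 2)\<^sup>2" by (simp add: power2_eq_square algebra_simps)
        moreover have "0 \<le> (t - 1 / 2)\<^sup>2" "0 \<le> t * (1 - t)" using t by auto
        ultimately show ?thesis by linarith
      qed
      ultimately show "cmod (\<sigma> (p g * (1 - p g))) < 1" by (simp only: norm_of_real)
    qed
    then have "p g * p g = p g" by (simp add: algebra_simps)
    then show ?thesis using conn unfolding is_connected_def by blast
  qed
  have "\<not> (\<forall>g\<in>G. p g = 0)" using sum_p by (metis sum.neutral zero_neq_one)
  then obtain g where g: "g \<in> G" "p g = 1" using p01 by blast
  \<comment> \<open>The square at \<open>g\<close> is 1 and exhausts the total in
    \<open>sum_sq\<close>, so every other component vanishes under all homomorphisms.\<close>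
  have "component h u = 0" if h: "h \<in> G" "h \<noteq> g" for h
  proof (rule embeddings_separate)
    fix \<sigma> :: "'a \<Rightarrow> complex" assume \<sigma>: "\<sigma> \<in> embeddings"
    have "(cmod (\<sigma> (component g u)))\<^sup>2 + (cmod (\<sigma> (component h u)))\<^sup>2
        = (\<Sum>g\<in>{g, h}. (cmod (\<sigma> (component g u)))\<^sup>2)" using h by simp
    also have "\<dots> \<le> 1"
      unfolding sum_sq[OF \<sigma>, symmetric] using g h finite_G by (intro sum_mono2) auto
    finally have "(cmod (\<sigma> (component h u)))\<^sup>2 \<le> 0"
      using \<sigma>_p[OF \<sigma> g(1)] g(2) embeddings_one[OF \<sigma>] by (simp flip: of_real_power)
    then show "\<sigma> (component h u) = \<sigma> 0" by (simp add: embeddings_zero \<sigma>)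
  qed
  then have "u = component g u"
    using sum.remove[OF finite_G g(1), of "\<lambda>g. component g u"] sum_component[of u] by simp
  then show ?thesis using g(1) component_piece[of g u] by auto
qed

end

section \<open>Two presentations of the same ring\<close>

lemma subring_zero: "subring S \<Longrightarrow> 0 \<in> S"
  unfolding subring_def by (metis diff_self)

lemma subring_sum: "subring S \<Longrightarrow> (\<And>i. i \<in> I \<Longrightarrow> f i \<in> S) \<Longrightarrow> sum f I \<in> S"
  by (induction I rule: infinite_finite_induct) (auto simp: subring_zero subring_def)

lemma idempotent_iterate_exists:
  assumes "finite H" and "\<And>h. h \<in> H \<Longrightarrow> \<theta> h \<in> H"
  shows "\<exists>N>0. \<forall>h\<in>H. (\<theta> ^^ N) ((\<theta> ^^ N) h) = (\<theta> ^^ N) h"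
proof -
  have closed: "(\<theta> ^^ i) h \<in> H" if "h \<in> H" for i h
    using that assms(2) by (induction i) auto
  have "range (\<lambda>i. restrict (\<theta> ^^ i) H) \<subseteq> PiE H (\<lambda>_. H)" using closed by auto
  then have "finite (range (\<lambda>i. restrict (\<theta> ^^ i) H))"
    by (rule finite_subset) (simp add: finite_PiE assms(1))
  then have "\<not> inj (\<lambda>i. restrict (\<theta> ^^ i) H)" by (auto dest: finite_imageD)
  then obtain i j where ij: "i < j" "restrict (\<theta> ^^ i) H = restrict (\<theta> ^^ j) H"
    unfolding inj_def by (metis nat_neq_iff)
  define p where "p = j - i"
  have period: "(\<theta> ^^ (m + p)) h = (\<theta> ^^ m) h" if "h \<in> H" "i \<le> m" for m h
  proof -
    have "(\<theta> ^^ (m + p)) h = (\<theta> ^^ (m - i)) ((\<theta> ^^ j) h)"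
      using that ij(1) by (simp add: p_def flip: funpow_add[THEN fun_cong, unfolded o_apply])
    also have "(\<theta> ^^ j) h = (\<theta> ^^ i) h" using fun_cong[OF ij(2), of h] that by simp
    also have "(\<theta> ^^ (m - i)) ((\<theta> ^^ i) h) = (\<theta> ^^ m) h"
      using that by (simp flip: funpow_add[THEN fun_cong, unfolded o_apply])
    finally show ?thesis .
  qed
  have multiple: "(\<theta> ^^ (m + q * p)) h = (\<theta> ^^ m) h" if "h \<in> H" "i \<le> m" for m q h
  proof (induction q)
    case (Suc q)
    then show ?case using period[OF that(1), of "m + q * p"] that(2) by (simp add: add_ac)
  qed simp
  \<comment> \<open>A positive multiple of the period \<open>p\<close> that is at least the
    preperiod \<open>i\<close>, so that adding \<open>?N\<close> to itself changes nothing.\<close>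
  let ?N = "Suc i * p"
  have p: "p > 0" using ij(1) by (simp add: p_def)
  have "(\<theta> ^^ ?N) ((\<theta> ^^ ?N) h) = (\<theta> ^^ ?N) h" if "h \<in> H" for h
  proof -
    have "i \<le> ?N" using p by (cases p) auto
    then have "(\<theta> ^^ (?N + ?N)) h = (\<theta> ^^ ?N) h" by (rule multiple[OF that])
    then show ?thesis by (simp only: funpow_add o_apply)
  qed
  then show ?thesis using p by (intro exI[of _ ?N]) simp
qed

section \<open>Splitting a group ring off a stark subring, and exchanging the group\<close>

context group_ring
begin

lemma G_inv_mult: "g \<in> G \<Longrightarrow> h \<in> G \<Longrightarrow> unit_inv (g * h) = unit_inv g * unit_inv h"
  by (rule unit_inv_eq) (metis G_inv(2) mult.assoc mult.commute mult.right_neutral)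

lemma G_nonzero: "g \<in> G \<Longrightarrow> g \<noteq> 0"
  using G_inv(2) by force

text \<open>The units \<open>w g\<close> realise the image of \<open>pr\<close> as a group
  \<open>K\<close> inside \<open>S\<close>, and the part \<open>C\<close> of \<open>S\<close> with
  degrees in the kernel of \<open>pr\<close> satisfies \<open>C[K] = S\<close>. Starkness makes
  \<open>K\<close> trivial, so 1 has degree \<open>pr g\<close>.\<close>

lemma stark_retraction_trivial:
  assumes S: "subring S" "stark S" and component_S: "\<And>x g. x \<in> S \<Longrightarrow> component g x \<in> S"
    and pr: "\<And>g. g \<in> G \<Longrightarrow> pr g \<in> G" "\<And>g h. g \<in> G \<Longrightarrow> h \<in> G \<Longrightarrow> pr (g * h) = pr g * pr h"
      "\<And>g. g \<in> G \<Longrightarrow> pr (pr g) = pr g"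
    and w: "\<And>g. g \<in> G \<Longrightarrow> w g \<in> S" "\<And>g. g \<in> G \<Longrightarrow> w g \<in> piece (pr g)" "w 1 = 1"
      "\<And>g h. g \<in> G \<Longrightarrow> h \<in> G \<Longrightarrow> w (g * h) = w g * w h"
    and "g \<in> G"
  shows "pr g = 1"
proof -
  define W where "W g = w (pr g)" for g
  \<comment> \<open>The grading coarsened along \<open>pr\<close>: all degrees lie in the fibre over
    \<open>t\<close>.\<close>
  define D where "D t = {x. \<forall>g\<in>G. component g x \<noteq> 0 \<longrightarrow> pr g = t}" for t
  have pr1: "pr 1 = 1"
    using pr(2)[OF G_one G_one] G_cancel[OF pr(1)[OF G_one], of "pr 1" 1] by simp
  have W_S: "W g \<in> S" and W_piece: "W g \<in> piece (pr g)" if "g \<in> G" for g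
    using w(1,2)[OF pr(1)[OF that]] pr(3)[OF that] by (auto simp: W_def)
  have W_mult: "W (g * h) = W g * W h" if "g \<in> G" "h \<in> G" for g h
    using that by (simp add: W_def pr w)
  have W_one: "W 1 = 1" by (simp add: W_def pr1 w)
  have W_inv: "W (unit_inv g) * W g = 1" if "g \<in> G" for g
    using W_mult[OF G_inv(1)[OF that] that] by (simp add: G_inv that W_one)
  have S_mult: "x * y \<in> S" and S_add: "x + y \<in> S" and S_diff: "x - y \<in> S"
    if "x \<in> S" "y \<in> S" for x y
    using S(1) that by (auto simp: subring_def)
  have piece_D: "x \<in> D (pr g)" if "x \<in> piece g" "g \<in> G" for x g
    using that by (auto simp: D_def component_of_piece split: if_splits)
  have D_mult: "x * y \<in> D (s * t)" if x: "x \<in> D s" and y: "y \<in> D t" for x y s t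
    unfolding D_def
  proof (intro CollectI ballI impI)
    fix g assume "g \<in> G" "component g (x * y) \<noteq> 0"
    then have "(\<Sum>h\<in>G. \<Sum>k\<in>G. component g (component h x * component k y)) \<noteq> 0"
      by (subst (asm) mult_eq_sum_component) (simp add: component_sum)
    then obtain h k where hk: "h \<in> G" "k \<in> G" "component g (component h x * component k y) \<noteq> 0"
      by (metis (no_types, lifting) sum.neutral)
    then have "g = h * k"
      using component_of_piece[OF piece_mult[OF component_piece component_piece] G_mult]
      by metis
    moreover have "component h x \<noteq> 0" "component k y \<noteq> 0"
      using hk(3) component_zero by auto
    ultimately show "pr g = s * t" using x y hk by (auto simp: D_def pr(2))
  qed
  define K where "K = W ` G"
  define C where "C = S \<inter> D 1"
  have sub_C: "subring C"
    unfolding subring_def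
  proof (intro conjI ballI)
    have "1 \<in> D (pr 1)" by (rule piece_D[OF piece_self G_one])
    then show "1 \<in> C" using S(1) by (simp add: C_def pr1 subring_def)
    fix x y assume xy: "x \<in> C" "y \<in> C"
    then show "x + y \<in> C"
      by (fastforce simp: C_def S_add D_def component_add)
    show "x - y \<in> C"
      using xy by (fastforce simp: C_def S_diff D_def component_diff)
    show "x * y \<in> C" using xy D_mult[of x 1 y 1] by (auto simp: C_def S_mult)
  qed
  have unit_K: "unit_subgroup K S"
    unfolding unit_subgroup_def
  proof (intro conjI ballI)
    show "K \<subseteq> S" using W_S by (auto simp: K_def)
    show "1 \<in> K" using W_one G_one by (force simp: K_def)
    show "k * l \<in> K" if "k \<in> K" "l \<in> K" for k l
      using that W_mult[symmetric] G_mult by (auto simp: K_def)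
    show "\<exists>l\<in>K. k * l = 1" if "k \<in> K" for k
      using that W_inv G_inv(1) by (auto simp: K_def mult.commute)
  qed
  have CK: "group_ring_eq C K S"
    unfolding group_ring_eq_def
  proof (intro conjI allI impI)
    show "{(\<Sum>g\<in>F. f g * g) | F f. finite F \<and> F \<subseteq> K \<and> f ` F \<subseteq> C} = S" (is "?L = S")
    proof
      show "?L \<subseteq> S"
        using unit_K by (auto simp: unit_subgroup_def C_def intro!: subring_sum[OF S(1)] S_mult)
      show "S \<subseteq> ?L"
      proof
        fix x assume x: "x \<in> S"
        \<comment> \<open>Dividing the component at \<open>g\<close> by \<open>W g\<close> moves its
          degree into the kernel of \<open>pr\<close>. Degrees with the same \<open>W g\<close>
          contribute to one coefficient.\<close>
        define f where "f k = (\<Sum>g\<in>{g\<in>G. W g = k}. component g x * W (unit_inv g))" for k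
        have "f k \<in> C" for k
          unfolding f_def
        proof (rule subring_sum[OF sub_C])
          fix g assume "g \<in> {g \<in> G. W g = k}"
          then have g: "g \<in> G" by simp
          have "component g x * W (unit_inv g) \<in> D (pr g * pr (pr (unit_inv g)))"
            using g by (intro D_mult piece_D W_piece component_piece G_inv pr)
          also have "pr g * pr (pr (unit_inv g)) = 1"
            using g by (simp add: pr G_inv pr1 flip: pr(2))
          finally show "component g x * W (unit_inv g) \<in> C"
            using g x by (simp add: C_def S_mult component_S W_S G_inv)
        qed
        moreover have "x = (\<Sum>k\<in>K. f k * k)"
        proof -
          have "(\<Sum>k\<in>K. f k * k) = (\<Sum>k\<in>K. \<Sum>g\<in>{g\<in>G. W g = k}. component g x)"
            unfolding f_def sum_distrib_right
            by (intro sum.cong refl) (auto simp: mult.assoc W_inv)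
          also have "\<dots> = (\<Sum>g\<in>G. component g x)"
            by (rule sum.group) (auto simp: K_def finite_G)
          finally show ?thesis by (simp add: sum_component)
        qed
        moreover have "finite K" by (simp add: K_def finite_G)
        ultimately show "x \<in> ?L" by blast
      qed
    qed
  next
    fix F f assume "finite F \<and> F \<subseteq> K \<and> f ` F \<subseteq> C \<and> (\<Sum>g\<in>F. f g * g) = 0"
    then have F: "finite F" "F \<subseteq> K" "f ` F \<subseteq> C" "(\<Sum>g\<in>F. f g * g) = 0" by auto
    have in_D: "f k * k \<in> D (pr h)" if "k \<in> F" "h \<in> G" "k = W h" for k h
    proof -
      have "f k \<in> D 1" using F(3) that(1) by (auto simp: C_def)
      moreover have "k \<in> D (pr (pr h))"
        using that W_piece pr(1) by (auto intro!: piece_D)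
      ultimately show ?thesis using D_mult[of "f k" 1 k "pr (pr h)"] that(2) by (simp add: pr)
    qed
    show "\<forall>k\<in>F. f k = 0"
    proof
      fix k0 assume k0: "k0 \<in> F"
      then obtain h0 where h0: "h0 \<in> G" "k0 = W h0" using F(2) by (auto simp: K_def)
      have "component g (f k0 * k0) = 0" if g: "g \<in> G" for g
      proof (rule ccontr)
        assume nz: "component g (f k0 * k0) \<noteq> 0"
        then have g0: "pr g = pr h0" using in_D[OF k0 h0] g by (auto simp: D_def)
        \<comment> \<open>\<open>W h\<close> depends only on \<open>pr h\<close>, so terms with
          different \<open>k\<close> lie over different fibres of \<open>pr\<close> and share no
          degree.\<close>
        have "component g (f k * k) = 0" if "k \<in> F - {k0}" for k
        proof (rule ccontr)
          assume nz: "component g (f k * k) \<noteq> 0"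
          obtain h where h: "h \<in> G" "k = W h" using \<open>k \<in> F - {k0}\<close> F(2) by (auto simp: K_def)
          then have "pr g = pr h" using in_D[of k h] that nz g by (auto simp: D_def)
          then have "k = k0" using g0 h h0 by (simp add: W_def)
          with that show False by simp
        qed
        then have "component g (\<Sum>k\<in>F. f k * k) = component g (f k0 * k0)"
          by (simp add: sum.remove[OF F(1) k0] component_add component_sum)
        then show False using nz by (simp add: F(4) component_zero)
      qed
      then have "f k0 * k0 = 0"
        using sum_component[of "f k0 * k0"] by simp
      then have "f k0 * (W (unit_inv h0) * W h0) = 0"
        using h0(2) by (simp add: mult.left_commute)
      then show "f k0 = 0" using W_inv[OF h0(1)] by simp
    qed
  qed
  have "C \<subseteq> S" by (simp add: C_def)
  then have "K = {1}" using S(2) sub_C unit_K CK unfolding stark_def by blast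
  then have "W g = 1" using \<open>g \<in> G\<close> unfolding K_def by blast
  then have "1 \<in> piece (pr g)" using W_piece[OF \<open>g \<in> G\<close>] by simp
  then show ?thesis
    using piece_unique[OF _ piece_self pr(1)[OF \<open>g \<in> G\<close>] G_one] by simp
qed

text \<open>Since \<open>h\<close> and \<open>\<phi> h\<close> differ by a unit of \<open>A\<close>,
  they span the same \<open>A\<close>-submodule, and the decomposition over \<open>G\<close> is
  relabelled by \<open>H\<close>.\<close>

lemma group_ring_eq_transfer:
  assumes H: "unit_subgroup H UNIV" and bij: "bij_betw \<phi> H G"
    and unit: "\<And>h. h \<in> H \<Longrightarrow> \<exists>a\<in>A. \<exists>a'\<in>A. a * a' = 1 \<and> h = a * \<phi> h"
  shows "group_ring_eq A H UNIV"
proof -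
  obtain a a' where a: "\<And>h. h \<in> H \<Longrightarrow> a h \<in> A" "\<And>h. h \<in> H \<Longrightarrow> a' h \<in> A"
    "\<And>h. h \<in> H \<Longrightarrow> a h * a' h = 1" "\<And>h. h \<in> H \<Longrightarrow> h = a h * \<phi> h"
    using unit by metis
  have \<phi>: "\<phi> h = a' h * h" if "h \<in> H" for h
  proof -
    have "a' h * h = a' h * (a h * \<phi> h)" using a(4)[OF that] by simp
    also have "\<dots> = (a h * a' h) * \<phi> h" by (simp add: mult_ac)
    finally show ?thesis using a(3)[OF that] by simp
  qed
  have fin_H: "finite H" using bij finite_G bij_betw_finite by blast
  show ?thesis
    unfolding group_ring_eq_def
  proof (intro conjI allI impI)
    show "{(\<Sum>g\<in>F. f g * g) | F f. finite F \<and> F \<subseteq> H \<and> f ` F \<subseteq> A} = UNIV" (is "?L = _")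
    proof (intro equalityI subset_UNIV subsetI)
      fix x
      obtain f where f: "\<And>g. f g \<in> A" "\<And>g. component g x = f g * g"
        using component_piece[of _ x] unfolding piece_def image_iff by metis
      have "x = (\<Sum>g\<in>G. f g * g)" by (simp add: sum_component flip: f(2))
      also have "\<dots> = (\<Sum>h\<in>H. f (\<phi> h) * \<phi> h)"
        by (rule sum.reindex_bij_betw[OF bij, symmetric])
      also have "\<dots> = (\<Sum>h\<in>H. (f (\<phi> h) * a' h) * h)"
        by (intro sum.cong refl) (metis \<phi> mult.assoc)
      finally have x: "x = (\<Sum>h\<in>H. (f (\<phi> h) * a' h) * h)" .
      have "(\<lambda>h. f (\<phi> h) * a' h) ` H \<subseteq> A" using f(1) a(2) by (auto intro: A_mult)
      with x fin_H show "x \<in> ?L"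
        by (intro CollectI exI[of _ H] exI[of _ "\<lambda>h. f (\<phi> h) * a' h"]) simp
    qed
  next
    fix F f assume "finite F \<and> F \<subseteq> H \<and> f ` F \<subseteq> A \<and> (\<Sum>g\<in>F. f g * g) = 0"
    then have F: "F \<subseteq> H" "f ` F \<subseteq> A" "(\<Sum>g\<in>F. f g * g) = 0" by auto
    define y where "y h = (if h \<in> F then f h * h else 0)" for h
    let ?inv = "inv_into H \<phi>"
    have inv: "?inv g \<in> H" "\<phi> (?inv g) = g" if "g \<in> G" for g
      using bij that by (auto simp: bij_betw_def inv_into_into f_inv_into_f)
    have "(\<Sum>g\<in>G. y (?inv g)) = (\<Sum>h\<in>H. y (?inv (\<phi> h)))"
      by (rule sum.reindex_bij_betw[OF bij, symmetric])
    also have "\<dots> = (\<Sum>h\<in>H. y h)"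
      using bij by (intro sum.cong) (auto simp: bij_betw_def)
    also have "\<dots> = 0"
      using F by (simp add: y_def sum.inter_restrict[OF fin_H, symmetric] Int_absorb1)
    finally have sum0: "(\<Sum>g\<in>G. y (?inv g)) = 0" .
    have piece: "y (?inv g) \<in> piece g" if "g \<in> G" for g
    proof (cases "?inv g \<in> F")
      case True
      have "y (?inv g) = (f (?inv g) * a (?inv g)) * g"
        using a(4)[OF inv(1)[OF that]] True inv(2)[OF that] by (simp add: y_def mult.assoc)
      then show ?thesis
        using F(2) True a(1)[OF inv(1)[OF that]] by (intro pieceI) (auto intro: A_mult)
    qed (simp add: y_def piece_zero)
    show "\<forall>h\<in>F. f h = 0"
    proof
      fix h assume h: "h \<in> F"
      then have hH: "h \<in> H" using F(1) by blast
      then have "\<phi> h \<in> G" "?inv (\<phi> h) = h" using bij by (auto simp: bij_betw_def)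
      then have "y h = 0" using piece_independent[OF piece sum0] by metis
      then have "f h * h = 0" using h by (simp add: y_def)
      moreover obtain h' where "h * h' = 1" using H hH unfolding unit_subgroup_def by blast
      ultimately show "f h = 0" by (metis mult.assoc mult.right_neutral mult_zero_left)
    qed
  qed
qed

text \<open>The degree in the grading, not that of a polynomial; for non-zero homogeneous
  \<open>u\<close> the choice is unique by \<open>piece_unique\<close>.\<close>

definition degree :: "'a \<Rightarrow> 'a" where
  "degree u = (SOME g. g \<in> G \<and> u \<in> piece g)"

end

lemma (in embedded_group_ring) degree_of_torsion_unit:
  assumes "is_connected TYPE('a)" and "unit_subgroup H UNIV" and "finite H" and "u \<in> H"
  shows "degree u \<in> G" and "u \<in> piece (degree u)"
proof -
  obtain k where "k > 0" "u ^ k = 1" using finite_unit_subgroup_torsion[OF assms(3,2,4)] by blast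
  then obtain g where "g \<in> G \<and> u \<in> piece g" using torsion_unit_homogeneous[OF assms(1)] by blast
  from someI[of "\<lambda>g. g \<in> G \<and> u \<in> piece g", OF this]
  show "degree u \<in> G" "u \<in> piece (degree u)" by (auto simp: degree_def)
qed

section \<open>Comparison of the two gradings and their degree maps\<close>

locale embedded_group_ring_pair =
  P: embedded_group_ring A G + Q: embedded_group_ring B H
  for A G B H :: "'a::comm_ring_1 set" +
  assumes conn: "is_connected TYPE('a)"
begin

text \<open>By orthogonality, splitting an element into its components decreases \<^const>\<open>sqnorm\<close> by
  at least 1, so every element is a sum of elements homogeneous for both gradings.\<close>
lemma components_commute:
  "P.component g (Q.component h x) = Q.component h (P.component g x)"
proof (induction "nat \<lfloor>sqnorm x\<rfloor>" arbitrary: x rule: less_induct)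
  case less
  have IH: "P.component g (Q.component h y) = Q.component h (P.component g y)"
    if "sqnorm y \<le> sqnorm x - 1" for y
  proof (rule less)
    have "0 \<le> \<lfloor>sqnorm y\<rfloor>" by (simp add: sqnorm_nonneg)
    moreover have "\<lfloor>sqnorm y\<rfloor> < \<lfloor>sqnorm x\<rfloor>" using that by linarith
    ultimately show "nat \<lfloor>sqnorm y\<rfloor> < nat \<lfloor>sqnorm x\<rfloor>" by linarith
  qed
  consider k where "P.component k x \<noteq> 0" "P.component k x \<noteq> x"
    | k where "Q.component k x \<noteq> 0" "Q.component k x \<noteq> x"
    | "\<And>k. P.component k x \<in> {0, x}" "\<And>k. Q.component k x \<in> {0, x}"
    by blast
  then show ?case
  proof cases
    case 1
    have "P.component g (Q.component h (\<Sum>k\<in>G. P.component k x))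
        = Q.component h (P.component g (\<Sum>k\<in>G. P.component k x))"
      unfolding P.component_sum Q.component_sum
      by (intro sum.cong refl IH P.sqnorm_component_descent[OF 1])
    then show ?thesis by (simp only: P.sum_component)
  next
    case 2
    have "P.component g (Q.component h (\<Sum>k\<in>H. Q.component k x))
        = Q.component h (P.component g (\<Sum>k\<in>H. Q.component k x))"
      unfolding P.component_sum Q.component_sum
      by (intro sum.cong refl IH Q.sqnorm_component_descent[OF 2])
    then show ?thesis by (simp only: Q.sum_component)
  next
    case 3
    from 3(1)[of g] 3(2)[of h] show ?thesis
      by (auto simp: P.component_zero Q.component_zero)
  qed
qed

text \<open>\<open>A\<close> is the part of \<open>G\<close>-degree 1, and the two families of
  projections commute. This makes \<open>A\<close> admissible in
  \<open>stark_retraction_trivial\<close> for the grading by \<open>H\<close>.\<close>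

lemma component_in_A:
  assumes "x \<in> A" shows "Q.component h x \<in> A"
proof -
  have "P.component 1 x = x"
    using assms P.component_of_piece[OF _ P.G_one, of x 1] by (simp add: P.piece_one)
  then have "Q.component h x = P.component 1 (Q.component h x)"
    by (simp add: components_commute)
  then show ?thesis using P.component_piece[of 1] by (metis P.piece_one)
qed

lemmas degree_H = P.degree_of_torsion_unit[OF conn Q.G Q.finite_G]
  and degree_G = Q.degree_of_torsion_unit[OF conn P.G P.finite_G]

lemma degree_H_mult:
  assumes "h \<in> H" "k \<in> H"
  shows "P.degree (h * k) = P.degree h * P.degree k"
proof (rule P.piece_unique)
  show "h * k \<in> P.piece (P.degree (h * k))" "P.degree (h * k) \<in> G"
    using degree_H assms Q.G_mult by auto
  show "h * k \<in> P.piece (P.degree h * P.degree k)" "P.degree h * P.degree k \<in> G"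
    using degree_H assms by (auto intro: P.piece_mult P.G_mult)
  show "h * k \<noteq> 0" using assms Q.G_mult Q.G_nonzero by blast
qed

lemma degree_H_one: "P.degree 1 = 1"
  using degree_H_mult[OF Q.G_one Q.G_one] degree_H(1)[OF Q.G_one]
    P.G_cancel[of "P.degree 1" "P.degree 1" 1] by simp

lemma degree_H_inv: "h \<in> H \<Longrightarrow> P.degree (unit_inv h) = unit_inv (P.degree h)"
  using degree_H_mult[of h "unit_inv h"]
  by (intro unit_inv_eq[symmetric]) (simp add: Q.G_inv degree_H_one)

lemma unit_inv_piece:
  assumes "g \<in> G" shows "unit_inv g \<in> Q.piece (unit_inv (Q.degree g))"
proof -
  have "Q.degree 1 = 1"
    using Q.piece_unique[OF degree_G(2)[OF P.G_one] Q.piece_self degree_G(1)[OF P.G_one] Q.G_one]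
    by simp
  moreover have "Q.degree g * Q.degree (unit_inv g) = Q.degree 1"
  proof (rule Q.piece_unique)
    show "1 \<in> Q.piece (Q.degree g * Q.degree (unit_inv g))"
      using Q.piece_mult[OF degree_G(2)[OF assms] degree_G(2)[OF P.G_inv(1)[OF assms]]]
      by (simp add: P.G_inv assms)
    show "Q.degree g * Q.degree (unit_inv g) \<in> H"
      by (intro Q.G_mult degree_G P.G_inv assms)
  qed (simp_all add: degree_G P.G_one)
  ultimately have "unit_inv (Q.degree g) = Q.degree (unit_inv g)"
    by (intro unit_inv_eq) simp
  then show ?thesis using degree_G(2)[OF P.G_inv(1)[OF assms]] by simp
qed

lemma degree_H_quotient:
  assumes "h \<in> H" shows "h * unit_inv (P.degree h) \<in> A"
proof -
  obtain a where a: "a \<in> A" "h = a * P.degree h"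
    using degree_H(2)[OF assms] unfolding P.piece_def by auto
  then have "h * unit_inv (P.degree h) = a * (P.degree h * unit_inv (P.degree h))"
    by (metis mult.assoc)
  then show ?thesis using a(1) by (simp add: P.G_inv degree_H assms)
qed

text \<open>Write \<open>\<theta>\<close> for the composite of the two degree maps, \<open>e = \<theta>\<^sup>N\<close> for an idempotent power of it and
  \<open>v h = h / degree h\<close>, an element of \<^term>\<open>A\<close> of \<^term>\<open>H\<close>-degree \<open>h / \<theta> h\<close>. The product of
  \<open>v (\<theta>\<^sup>i h)\<close> over \<open>i < N\<close> telescopes to an element of \<^term>\<open>A\<close> of \<^term>\<open>H\<close>-degree \<open>h / e h\<close>,
  so \<^term>\<open>A\<close> is a group ring over the kernel of \<open>e\<close>.\<close>
lemma inj_on_degree: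
  assumes "stark A"
  shows "inj_on P.degree H"
proof -
  define \<theta> where "\<theta> h = Q.degree (P.degree h)" for h
  define v where "v h = h * unit_inv (P.degree h)" for h
  define w where "w m h = (\<Prod>i<m. v ((\<theta> ^^ i) h))" for m h
  have \<theta>_H: "\<theta> h \<in> H" if "h \<in> H" for h
    using that by (simp add: \<theta>_def degree_H degree_G)
  \<comment> \<open>By symmetry this supplies the multiplicativity of
    \<open>Q.degree\<close>.\<close>
  interpret swap: embedded_group_ring_pair B H A G
    by unfold_locales (rule conn)
  have \<theta>_mult: "\<theta> (h * k) = \<theta> h * \<theta> k" if "h \<in> H" "k \<in> H" for h k
    using that by (simp add: \<theta>_def degree_H degree_H_mult swap.degree_H_mult)
  have \<theta>_one: "\<theta> 1 = 1" by (simp add: \<theta>_def degree_H_one swap.degree_H_one)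
  have iter_H: "(\<theta> ^^ m) h \<in> H" if "h \<in> H" for m h
    using that by (induction m) (simp_all add: \<theta>_H)
  have iter_mult: "(\<theta> ^^ m) (h * k) = (\<theta> ^^ m) h * (\<theta> ^^ m) k" if "h \<in> H" "k \<in> H" for m h k
    using that by (induction m) (simp_all add: \<theta>_mult iter_H)
  have iter_one: "(\<theta> ^^ m) 1 = 1" for m by (induction m) (simp_all add: \<theta>_one)
  have v_mult: "v (h * k) = v h * v k" if "h \<in> H" "k \<in> H" for h k
    using that by (simp add: v_def degree_H_mult P.G_inv_mult degree_H mult_ac)
  have v_one: "v 1 = 1" using unit_inv_eq[of "1::'a" 1] by (simp add: v_def degree_H_one)
  have v_\<theta>: "v h * \<theta> h \<in> Q.piece h" if h: "h \<in> H" for h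
  proof -
    have "v h \<in> Q.piece (h * unit_inv (\<theta> h))"
      unfolding v_def \<theta>_def
      by (intro Q.piece_mult Q.piece_self unit_inv_piece degree_H h)
    from Q.piece_mult[OF this Q.piece_self, of "\<theta> h"] show ?thesis
      by (simp add: mult.assoc Q.G_inv \<theta>_H h)
  qed
  \<comment> \<open>The telescoping in division-free form: each factor \<open>v\<close> trades one
    iterate of \<open>\<theta>\<close> for the next, up to an element of \<open>B\<close>.\<close>
  have w_piece: "w m h * (\<theta> ^^ m) h \<in> Q.piece h" if h: "h \<in> H" for m h
  proof (induction m)
    case 0
    then show ?case by (simp add: w_def Q.piece_self)
  next
    case (Suc m)
    let ?k = "(\<theta> ^^ m) h"
    obtain b where b: "b \<in> B" "v ?k * \<theta> ?k = b * ?k"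
      using v_\<theta>[OF iter_H[OF h, of m]] unfolding Q.piece_def by auto
    have "w (Suc m) h * (\<theta> ^^ Suc m) h = w m h * (v ?k * \<theta> ?k)"
      by (simp add: w_def mult.assoc)
    also have "\<dots> = b * (w m h * ?k)" unfolding b(2) by (simp add: mult_ac)
    finally have eq: "w (Suc m) h * (\<theta> ^^ Suc m) h = b * (w m h * ?k)" .
    have "b \<in> Q.piece 1" using b(1) by (simp add: Q.piece_one)
    from Q.piece_mult[OF this Suc] eq show ?case by simp
  qed
  have "\<exists>N>0. \<forall>h\<in>H. (\<theta> ^^ N) ((\<theta> ^^ N) h) = (\<theta> ^^ N) h"
    by (rule idempotent_iterate_exists[OF Q.finite_G \<theta>_H])
  then obtain N where N: "N > 0" "\<And>h. h \<in> H \<Longrightarrow> (\<theta> ^^ N) ((\<theta> ^^ N) h) = (\<theta> ^^ N) h"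
    by auto
  define e where "e = \<theta> ^^ N"
  have e: "e h \<in> H" "e (e h) = e h" if "h \<in> H" for h
    using that by (simp_all add: e_def iter_H N)
  have e_mult: "e (h * k) = e h * e k" if "h \<in> H" "k \<in> H" for h k
    using that by (simp add: e_def iter_mult)
  have e_inv: "e (unit_inv h) = unit_inv (e h)" if "h \<in> H" for h
    using e_mult[OF that Q.G_inv(1)[OF that]] iter_one[of N]
    by (intro unit_inv_eq[symmetric]) (simp add: Q.G_inv that e_def)
  \<comment> \<open>The projection onto the kernel of \<open>e\<close> along its image; once it is
    trivial, \<open>e\<close> is the identity on \<open>H\<close>.\<close>
  define pr where "pr h = h * unit_inv (e h)" for h
  have pr1: "pr h = 1" if "h \<in> H" for h
  proof (rule Q.stark_retraction_trivial[OF P.A \<open>stark A\<close> component_in_A, where pr = pr and w = "w N"])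
    fix h k assume h: "h \<in> H"
    show pr_H: "pr h \<in> H" using h by (simp add: pr_def Q.G_mult Q.G_inv e)
    have "e (pr h) = 1"
      using h by (simp add: pr_def e_mult e_inv e Q.G_inv)
    then show "pr (pr h) = pr h"
      using unit_inv_eq[of "1::'a" 1] by (simp add: pr_def[of "pr h"])
    show "w N h \<in> A"
      unfolding w_def
    proof (induction N)
      case (Suc m)
      then show ?case
        using degree_H_quotient[OF iter_H[OF h, of m]] by (simp add: v_def P.A_mult)
    qed (simp add: P.A_one)
    have "w N h * e h * unit_inv (e h) \<in> Q.piece (h * unit_inv (e h))"
      using w_piece[OF h, of N] by (intro Q.piece_mult Q.piece_self) (simp add: e_def)
    then show "w N h \<in> Q.piece (pr h)"
      by (simp add: mult.assoc Q.G_inv e h pr_def)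
    assume k: "k \<in> H"
    show "pr (h * k) = pr h * pr k"
      using h k by (simp add: pr_def e_mult Q.G_inv_mult e mult_ac)
    show "w N (h * k) = w N h * w N k"
      using h k by (simp add: w_def iter_mult v_mult iter_H prod.distrib)
  qed (use that in \<open>simp_all add: w_def iter_one v_one\<close>)
  have e_id: "e h = h" if "h \<in> H" for h
  proof -
    have "h * (unit_inv (e h) * e h) = e h"
      using pr1[OF that] by (simp add: pr_def flip: mult.assoc)
    then show ?thesis by (simp add: Q.G_inv e that)
  qed
  \<comment> \<open>Positivity of \<open>N\<close> makes \<open>e\<close> factor through
    \<open>\<theta>\<close>, hence through \<open>P.degree\<close>.\<close>
  obtain M where M: "N = Suc M" using N(1) by (cases N) auto
  show ?thesis
  proof (rule inj_onI)
    fix h k assume hk: "h \<in> H" "k \<in> H" "P.degree h = P.degree k"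
    then have "\<theta> h = \<theta> k" by (simp add: \<theta>_def)
    then have "e h = e k" by (simp only: e_def M funpow_Suc_right o_apply)
    then show "h = k" using e_id hk by simp
  qed
qed

text \<open>The quotient of \<open>h\<close> by its degree lies in \<open>A\<close>, and so does its
  inverse, being the same quotient formed for \<open>unit_inv h\<close>.\<close>

lemma group_ring_eq_swap:
  assumes "bij_betw P.degree H G"
  shows "group_ring_eq A H UNIV"
proof (rule P.group_ring_eq_transfer[OF Q.G assms])
  fix h assume h: "h \<in> H"
  let ?g = "P.degree h"
  have g: "?g \<in> G" by (rule degree_H(1)[OF h])
  show "\<exists>a\<in>A. \<exists>a'\<in>A. a * a' = 1 \<and> h = a * ?g"
  proof (intro bexI conjI)
    have "h * unit_inv ?g * (unit_inv h * ?g) = (h * unit_inv h) * (?g * unit_inv ?g)"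
      by (simp add: mult_ac)
    then show "h * unit_inv ?g * (unit_inv h * ?g) = 1"
      by (simp add: Q.G_inv P.G_inv g h)
    show "h = h * unit_inv ?g * ?g" by (simp add: mult.assoc P.G_inv g)
    show "h * unit_inv ?g \<in> A" by (rule degree_H_quotient[OF h])
    show "unit_inv h * ?g \<in> A"
      using degree_H_quotient[OF Q.G_inv(1)[OF h]] by (simp add: degree_H_inv h P.G_inv_inv g)
  qed
qed

end

theorem theorem1p3:
  fixes A B G H :: "'a::comm_ring_1 set"
  assumes "is_order TYPE('a)" and "is_reduced TYPE('a)" and "is_connected TYPE('a)"
    and "subring A" and "subring B" and "stark A" and "stark B"
    and "unit_subgroup G UNIV" and "unit_subgroup H UNIV"
    and "group_ring_eq A G UNIV" and "group_ring_eq B H UNIV"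
  shows "group_ring_eq A H UNIV \<and> group_ring_eq B G UNIV"
proof -
  have embedded: "embedded_group_ring S K"
    if "subring S" "unit_subgroup K UNIV" "group_ring_eq S K UNIV" for S K :: "'a set"
  proof unfold_locales
    show "finite K"
      using order_finite_of_group_ring_eq[OF assms(1) that(1,3)] .
    show "z = 0" if "\<And>\<sigma>. \<sigma> \<in> embeddings \<Longrightarrow> cmod (\<sigma> z) < 1" for z :: 'a
      using reduced_order_eq_0[OF assms(1,2)] that by blast
  qed (use that order_finite_embeddings[OF assms(1)] in auto)
  interpret P: embedded_group_ring A G by (rule embedded) fact+
  interpret Q: embedded_group_ring B H by (rule embedded) fact+
  interpret PQ: embedded_group_ring_pair A G B H by unfold_locales fact
  interpret QP: embedded_group_ring_pair B H A G by unfold_locales fact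
  have maps: "P.degree ` H \<subseteq> G" "Q.degree ` G \<subseteq> H"
    using PQ.degree_H(1) QP.degree_H(1) by auto
  have inj: "inj_on P.degree H" "inj_on Q.degree G"
    using PQ.inj_on_degree QP.inj_on_degree assms by auto
  \<comment> \<open>Injections in both directions equate the finite cardinalities, which makes each
    degree map surjective.\<close>
  have card: "card H = card G"
    using card_inj_on_le[OF inj(1) maps(1) P.finite_G] card_inj_on_le[OF inj(2) maps(2) Q.finite_G]
    by (rule antisym)
  have "bij_betw P.degree H G" "bij_betw Q.degree G H"
    using card_subset_eq[OF P.finite_G maps(1)] card_subset_eq[OF Q.finite_G maps(2)] inj card
    by (simp_all add: bij_betw_def card_image)
  then show ?thesis using PQ.group_ring_eq_swap QP.group_ring_eq_swap by blast
qed

end
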